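(* Suppose that $\mathcal S_{\mathrm{add}}=(\mathcal P_{\mathrm{add}}\mathcal S_*\mathcal P_{\mathrm{add}})|_{\mathcal F_{\mathrm{add}}}$ has a continuous inverse on $\mathcal F_{\mathrm{add}}$ (so that the $\|\cdot\|_*$-projection $\mathcal P_*$ onto $\mathcal F_{\mathrm{add}}$ and $\widehat{\underline r}_{\mathrm{add}}$ are well defined). Let $R\ge0$ and let $\widehat{\underline r}_R$ be the penalized estimator. Then $$\mathcal P_*\widehat{\underline r}_R=\widehat{\underline r}_{\mathrm{add}}.$$
   Context: **Data and kernel.** Data $(\underline{\mathbf X}_i,Y_i)\in[0,1]^d\times\mathbb R$, $i=1,\dots,n$; bandwidths $h_1,\dots,h_d>0$. $K\ge0$ is a univariate kernel that is bounded, has compact support, is symmetric about zero and Lipschitz continuous; the product kernel, rescaled at the boundary to satisfy $\int_{[0,1]^d}K_h(\underline{\mathbf X}_i,\underline{\mathbf x})\,d\underline{\mathbf x}=1$, is $$K_h(\underline{\mathbf X}_i,\underline{\mathbf x})=\prod_{k=1}^d \frac{K((X_{i,k}-x_k)/h_k)}{\int_0^1K((X_{i,k}-t)/h_k)\,dt}.$$ **Spaces and operators.** $\mathcal F_{\mathrm{full}}$ is the space of $\underline r=(r^0,\dots,r^d)$ with $r^\ell:[0,1]^d\to\mathbb R$ square integrable, $\|\underline r\|_2^2=\sum_{\ell=0}^d\int r^\ell(\underline{\mathbf x})^2d\underline{\mathbf x}$. $\mathcal F_{\mathrm{add}}\subset\mathcal F_{\mathrm{full}}$ consists of those $\underline r$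 for which $r^0$ is additive (a sum of functions of single coordinates) and, for $k=1,\dots,d$, $r^k(\underline{\mathbf x})$ depends only on $x_k$. $\mathcal P_{\mathrm{add}}$ is the $\|\cdot\|_2$-orthogonal projection onto $\mathcal F_{\mathrm{add}}$; $\mathcal I$ is the identity. The design-dependent seminorm on $\mathcal F_{\mathrm{full}}$ is $$\|\underline r\|_*^2=\int_{[0,1]^d}\frac1n\sum_{i=1}^n\Big[r^0(\underline{\mathbf x})+\sum_{k=1}^dr^k(\underline{\mathbf x})\tfrac{X_{i,k}-x_k}{h_k}\Big]^2K_h(\underline{\mathbf X}_i,\underline{\mathbf x})\,d\underline{\mathbf x}=\langle\underline r,\mathcal S_*\underline r\rangle_2,$$ where $(\mathcal S_*\underline r)(\underline{\mathbf x})=\mathbf S(\underline{\mathbf x})\underline r(\underline{\mathbf x})$ and $\mathbf S(\underline{\mathbf x})$ has entries $\frac1n\sum_iK_h(\underline{\mathbf X}_i,\underline{\mathbf x})u_{i,\ell}(\underline{\mathbf x})u_{i,l}(\underline{\mathbf x})$, $\ell,l=0,\dots,d$, with $u_{i,0}=1$, $u_{i,k}(\underline{\mathbf x})=(X_{i,k}-x_k)/h_k$. $\mathcal P_*:\mathcal F_{\mathrm{full}}\to\mathcal F_{\mathrm{add}}$ is the $\|\cdot\|_*$-orthogonal projection: $\mathcal P_*\underline r=\arg\min_{\underline s\in\mathcal F_{\mathrm{add}}}\|\underline r-\underline s\|_*^2$. **Estimators.** Let $$Q(\underline r)=\int_{[0,1]^d}\frac1n\sum_{i=1}^n\Big[Y_i-r^0(\underline{\mathbf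 x})-\sum_{k=1}^dr^k(\underline{\mathbf x})\tfrac{X_{i,k}-x_k}{h_k}\Big]^2K_h(\underline{\mathbf X}_i,\underline{\mathbf x})\,d\underline{\mathbf x}.$$ $\widehat{\underline r}_{\mathrm{add}}$ is the minimizer of $Q$ over $\mathcal F_{\mathrm{add}}$; $\widehat{\underline r}_R$ is a minimizer over $\mathcal F_{\mathrm{full}}$ of $Q(\underline r)+R\|(\mathcal I-\mathcal P_{\mathrm{add}})\underline r\|_2^2$. *)

theory Defs
  imports "HOL-Analysis.Analysis"
begin

text \<open>
  The dimension is \<open>CARD('d)\<close>. An element \<open>(r\<^sup>0, ..., r\<^sup>d)\<close> of the function space is represented by
  a single vector-valued function \<open>r\<close> whose components are indexed by \<open>'d option\<close>:
  \<open>r x $ None\<close> is \<open>r\<^sup>0(x)\<close> and \<open>r x $ Some k\<close> is \<open>r\<^sup>k(x)\<close>.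
  Elements of the space are classes modulo equality almost everywhere; we work with
  representatives, and \<open>l2_eq\<close> is the equality of the space.
\<close>

type_synonym 'd fn_tuple = "real^'d \<Rightarrow> real^('d option)"

definition cube_measure :: "(real^'d) measure" where
  "cube_measure = lebesgue_on (cbox 0 1)"

definition l2_eq :: "'d::finite fn_tuple \<Rightarrow> 'd fn_tuple \<Rightarrow> bool" where
  "l2_eq r s \<longleftrightarrow> (AE x in cube_measure. r x = s x)"

definition F_full :: "'d::finite fn_tuple set" where
  "F_full = {r. \<forall>l. (\<lambda>x. r x $ l) \<in> borel_measurable cube_measure \<and>
                    integrable cube_measure (\<lambda>x. (r x $ l)\<^sup>2)}"

definition l2_inner :: "'d::finite fn_tuple \<Rightarrow> 'd fn_tuple \<Rightarrow> real" where
  "l2_inner r s = (\<Sum>l\<in>UNIV. \<integral>x. r x $ l * s x $ l \<partial>cube_measure)"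

definition l2_norm :: "'d::finite fn_tuple \<Rightarrow> real" where
  "l2_norm r = sqrt (\<Sum>l\<in>UNIV. \<integral>x. (r x $ l)\<^sup>2 \<partial>cube_measure)"

text \<open>
  The structural conditions hold almost everywhere, so that \<open>F_add\<close> is closed under \<open>l2_eq\<close>. No
  regularity of the univariate functions is required beyond what \<open>r \<in> F_full\<close> implies.
\<close>

definition F_add :: "'d::finite fn_tuple set" where
  "F_add = {r \<in> F_full.
     (\<exists>f :: 'd \<Rightarrow> real \<Rightarrow> real. AE x in cube_measure. r x $ None = (\<Sum>k\<in>UNIV. f k (x $ k))) \<and>
     (\<forall>k. \<exists>g :: real \<Rightarrow> real. AE x in cube_measure. r x $ Some k = g (x $ k))}"

text \<open>A representative of the orthogonal projection, which is determined up to \<open>l2_eq\<close>.\<close>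

definition P_add :: "'d::finite fn_tuple \<Rightarrow> 'd fn_tuple" where
  "P_add r = (SOME s. s \<in> F_add \<and> (\<forall>t\<in>F_add. l2_inner (r - s) t = 0))"

text \<open>If one of the normalizing integrals vanishes, \<open>K_h\<close> is \<open>0\<close> by the convention on division.\<close>

definition K_h :: "(real \<Rightarrow> real) \<Rightarrow> real^'d \<Rightarrow> real^'d \<Rightarrow> real^'d \<Rightarrow> real" where
  "K_h K h Xi x =
     (\<Prod>k\<in>UNIV. K ((Xi $ k - x $ k) / h $ k) /
                (\<integral>t. K ((Xi $ k - t) / h $ k) \<partial>lebesgue_on {0..1}))"

definition u_vec :: "real^'d \<Rightarrow> real^'d \<Rightarrow> real^'d \<Rightarrow> real^('d option)" where
  "u_vec h Xi x = (\<chi> l. case l of None \<Rightarrow> 1 | Some k \<Rightarrow> (Xi $ k - x $ k) / h $ k)"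

definition star_seminorm ::
    "(real \<Rightarrow> real) \<Rightarrow> real^'d \<Rightarrow> nat \<Rightarrow> (nat \<Rightarrow> real^'d) \<Rightarrow> 'd::finite fn_tuple \<Rightarrow> real" where
  "star_seminorm K h n X r = sqrt (\<integral>x. 1 / real n * (\<Sum>i=1..n.
      (r x $ None + (\<Sum>k\<in>UNIV. r x $ Some k * ((X i $ k - x $ k) / h $ k)))\<^sup>2 * K_h K h (X i) x)
      \<partial>cube_measure)"

definition S_mat ::
    "(real \<Rightarrow> real) \<Rightarrow> real^'d \<Rightarrow> nat \<Rightarrow> (nat \<Rightarrow> real^'d) \<Rightarrow> real^'d
      \<Rightarrow> real^('d::finite option)^('d option)" where
  "S_mat K h n X x =
     (\<chi> l m. 1 / real n * (\<Sum>i=1..n. K_h K h (X i) x * u_vec h (X i) x $ l * u_vec h (X i) x $ m))"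

definition S_star ::
    "(real \<Rightarrow> real) \<Rightarrow> real^'d \<Rightarrow> nat \<Rightarrow> (nat \<Rightarrow> real^'d) \<Rightarrow> 'd::finite fn_tuple \<Rightarrow> 'd fn_tuple" where
  "S_star K h n X r = (\<lambda>x. S_mat K h n X x *v r x)"

definition S_add ::
    "(real \<Rightarrow> real) \<Rightarrow> real^'d \<Rightarrow> nat \<Rightarrow> (nat \<Rightarrow> real^'d) \<Rightarrow> 'd::finite fn_tuple \<Rightarrow> 'd fn_tuple" where
  "S_add K h n X r = P_add (S_star K h n X (P_add r))"

text \<open>
  The operator \<open>A\<close>, restricted to \<open>F\<close>, has a two-sided inverse \<open>T\<close> (modulo \<open>l2_eq\<close>) that is continuous
  with respect to \<open>l2_norm\<close>. Continuity implies that \<open>T\<close> respects \<open>l2_eq\<close>.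
\<close>

definition has_continuous_inverse_on ::
    "'d::finite fn_tuple set \<Rightarrow> ('d fn_tuple \<Rightarrow> 'd fn_tuple) \<Rightarrow> bool" where
  "has_continuous_inverse_on F A \<longleftrightarrow> (\<exists>T.
     (\<forall>r\<in>F. T r \<in> F \<and> l2_eq (A (T r)) r \<and> l2_eq (T (A r)) r) \<and>
     (\<forall>r\<in>F. \<forall>\<epsilon>>0. \<exists>\<delta>>0. \<forall>s\<in>F. l2_norm (s - r) < \<delta> \<longrightarrow> l2_norm (T s - T r) < \<epsilon>))"

definition has_unique_minimizer_on :: "'d::finite fn_tuple set \<Rightarrow> ('d fn_tuple \<Rightarrow> real) \<Rightarrow> bool" where
  "has_unique_minimizer_on F J \<longleftrightarrow>
     (\<exists>s. is_arg_min J (\<lambda>s. s \<in> F) s \<and> (\<forall>t. is_arg_min J (\<lambda>s. s \<in> F) t \<longrightarrow> l2_eq t s))"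

definition P_star ::
    "(real \<Rightarrow> real) \<Rightarrow> real^'d \<Rightarrow> nat \<Rightarrow> (nat \<Rightarrow> real^'d) \<Rightarrow> 'd::finite fn_tuple \<Rightarrow> 'd fn_tuple" where
  "P_star K h n X r = arg_min (\<lambda>s. (star_seminorm K h n X (r - s))\<^sup>2) (\<lambda>s. s \<in> F_add)"

definition Q ::
    "(real \<Rightarrow> real) \<Rightarrow> real^'d \<Rightarrow> nat \<Rightarrow> (nat \<Rightarrow> real^'d) \<Rightarrow> (nat \<Rightarrow> real) \<Rightarrow> 'd::finite fn_tuple \<Rightarrow> real"
  where
  "Q K h n X Y r = (\<integral>x. 1 / real n * (\<Sum>i=1..n.
      (Y i - r x $ None - (\<Sum>k\<in>UNIV. r x $ Some k * ((X i $ k - x $ k) / h $ k)))\<^sup>2 * K_h K h (X i) x)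
      \<partial>cube_measure)"

definition r_add ::
    "(real \<Rightarrow> real) \<Rightarrow> real^'d \<Rightarrow> nat \<Rightarrow> (nat \<Rightarrow> real^'d) \<Rightarrow> (nat \<Rightarrow> real) \<Rightarrow> 'd::finite fn_tuple" where
  "r_add K h n X Y = arg_min (Q K h n X Y) (\<lambda>r. r \<in> F_add)"

definition is_penalized_estimator ::
    "(real \<Rightarrow> real) \<Rightarrow> real^'d \<Rightarrow> nat \<Rightarrow> (nat \<Rightarrow> real^'d) \<Rightarrow> (nat \<Rightarrow> real) \<Rightarrow> real
      \<Rightarrow> 'd::finite fn_tuple \<Rightarrow> bool" where
  "is_penalized_estimator K h n X Y R r \<longleftrightarrow>
     is_arg_min (\<lambda>r. Q K h n X Y r + R * (l2_norm (r - P_add r))\<^sup>2) (\<lambda>r. r \<in> F_full) r"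

end

theory Submission
  imports Defs "HOL-Probability.Probability_Measure"
begin

text \<open>
  Write \<open>\<langle>\<cdot>, \<cdot>\<rangle>\<close> for \<open>l2_inner\<close> and \<open>S\<close> for \<open>S_star\<close>. With \<open>b = n\<^sup>-\<^sup>1 \<Sum>\<^sub>i K_h(X\<^sub>i, \<cdot>) Y\<^sub>i u\<^sub>i\<close>
  the criterion is \<open>Q(r) = const - 2 \<langle>b, r\<rangle> + \<langle>r, S r\<rangle>\<close>, so its minimizers over \<open>F_add\<close> are the solutions
  \<open>s \<in> F_add\<close> of \<open>\<langle>S s - b, t\<rangle> = 0\<close> for all \<open>t \<in> F_add\<close>. The penalty does not change when \<open>t \<in> F_add\<close> is
  added to \<open>r\<close>, so a penalized estimator satisfies \<open>\<langle>S r_R - b, t\<rangle> = 0\<close> for these \<open>t\<close> too; hence the normal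
  equations \<open>\<langle>S s - S r_R, t\<rangle> = 0\<close> of \<open>P_star r_R\<close> are those of \<open>r_add\<close>. They are solved by applying
  the inverse of \<open>S_add\<close> to \<open>P_add b\<close>, and by the Cauchy-Schwarz argument for the semidefinite form
  \<open>\<langle>\<cdot>, S \<cdot>\<rangle>\<close> the solution is unique.

  The projection \<open>P_add\<close> exists because it is explicit: averaging out all coordinates but the
  \<open>k\<close>-th gives a projection \<open>E\<^sub>k\<close>, and \<open>\<Sum>\<^sub>k E\<^sub>k - (d - 1) E\<close> is the projection onto the additive
  functions. Symmetry of \<open>E\<^sub>k\<close> expresses that exchanging the \<open>k\<close>-th coordinates of two independent
  uniform points of the cube preserves their joint distribution.
\<close>

subsection \<open>Square-integrable functions\<close>

text \<open>Measurability of \<open>f\<close> is a separate clause because integrability of the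
  square only makes the square measurable.\<close>

definition sq_integrable :: "'a measure \<Rightarrow> ('a \<Rightarrow> real) \<Rightarrow> bool" where
  "sq_integrable M f \<longleftrightarrow> f \<in> borel_measurable M \<and> integrable M (\<lambda>x. (f x)\<^sup>2)"

lemma sq_integrable_measurable: "sq_integrable M f \<Longrightarrow> f \<in> borel_measurable M"
  by (simp add: sq_integrable_def)

lemma sq_integrable_mult_integrable:
  assumes "sq_integrable M f" "sq_integrable M g"
  shows "integrable M (\<lambda>x. f x * g x)"
proof (rule Bochner_Integration.integrable_bound)
  show "integrable M (\<lambda>x. (f x)\<^sup>2 + (g x)\<^sup>2)"
    using assms by (simp add: sq_integrable_def)
  show "(\<lambda>x. f x * g x) \<in> borel_measurable M"
    using assms by (auto simp: sq_integrable_def)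
  have "\<bar>a * b\<bar> \<le> a\<^sup>2 + b\<^sup>2" for a b :: real
    using sum_squares_bound[of "\<bar>a\<bar>" "\<bar>b\<bar>"] mult_nonneg_nonneg[of "\<bar>a\<bar>" "\<bar>b\<bar>"]
    by (simp add: abs_mult del: mult_nonneg_nonneg)
  then show "AE x in M. norm (f x * g x) \<le> norm ((f x)\<^sup>2 + (g x)\<^sup>2)"
    by auto
qed

lemma sq_integrable_scale: "sq_integrable M f \<Longrightarrow> sq_integrable M (\<lambda>x. c * f x)"
  by (auto simp: sq_integrable_def power_mult_distrib)

lemma sq_integrable_add:
  assumes "sq_integrable M f" "sq_integrable M g"
  shows "sq_integrable M (\<lambda>x. f x + g x)"
  using assms sq_integrable_mult_integrable[OF assms]
  by (auto simp: sq_integrable_def power2_sum mult.assoc)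

lemma sq_integrable_diff:
  assumes "sq_integrable M f" "sq_integrable M g"
  shows "sq_integrable M (\<lambda>x. f x - g x)"
  using sq_integrable_add[OF assms(1) sq_integrable_scale[OF assms(2), of "-1"]] by simp

lemma sq_integrable_zero: "sq_integrable M (\<lambda>x. 0)"
  by (simp add: sq_integrable_def)

lemma sq_integrable_sum:
  "(\<And>i. i \<in> I \<Longrightarrow> sq_integrable M (f i)) \<Longrightarrow> sq_integrable M (\<lambda>x. \<Sum>i\<in>I. f i x)"
  by (induction I rule: infinite_finite_induct) (auto intro: sq_integrable_zero sq_integrable_add)

lemma sq_integrable_bounded_mult:
  assumes f: "sq_integrable M f" and g: "g \<in> borel_measurable M"
    and B: "\<And>x. x \<in> space M \<Longrightarrow> \<bar>g x\<bar> \<le> B"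
  shows "sq_integrable M (\<lambda>x. g x * f x)"
  unfolding sq_integrable_def
proof
  note [measurable] = g sq_integrable_measurable[OF f]
  show "(\<lambda>x. g x * f x) \<in> borel_measurable M" by measurable
  show "integrable M (\<lambda>x. (g x * f x)\<^sup>2)"
  proof (rule Bochner_Integration.integrable_bound)
    show "integrable M (\<lambda>x. B\<^sup>2 * (f x)\<^sup>2)"
      using f by (simp add: sq_integrable_def)
    have "(g x)\<^sup>2 \<le> B\<^sup>2" if "x \<in> space M" for x
      using B[OF that] by (metis abs_le_square_iff abs_ge_self order_trans abs_ge_zero abs_of_nonneg)
    then show "AE x in M. norm ((g x * f x)\<^sup>2) \<le> norm (B\<^sup>2 * (f x)\<^sup>2)"
      by (auto simp: power_mult_distrib intro!: mult_right_mono)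
  qed measurable
qed

lemma (in prob_space) sq_integrable_integrable:
  assumes "sq_integrable M f"
  shows "integrable M f"
  using sq_integrable_mult_integrable[OF assms, of "\<lambda>_. 1"] by (simp add: sq_integrable_def)

lemma (in prob_space) sq_integrable_const: "sq_integrable M (\<lambda>x. c)"
  by (simp add: sq_integrable_def)

text \<open>The variance of \<open>f\<close> is nonnegative. This case of Jensen's inequality bounds
  the square of a coordinate mean.\<close>

lemma (in prob_space) square_integral_le:
  fixes f :: "'a \<Rightarrow> real"
  assumes "integrable M f" "integrable M (\<lambda>x. (f x)\<^sup>2)"
  shows "(\<integral>x. f x \<partial>M)\<^sup>2 \<le> (\<integral>x. (f x)\<^sup>2 \<partial>M)"
proof -
  define m where "m = (\<integral>x. f x \<partial>M)"
  have "0 \<le> (\<integral>x. (f x - m)\<^sup>2 \<partial>M)" by simp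
  also have "\<dots> = (\<integral>x. (f x)\<^sup>2 - 2 * m * f x + m\<^sup>2 \<partial>M)"
    by (simp add: power2_diff algebra_simps)
  also have "\<dots> = (\<integral>x. (f x)\<^sup>2 \<partial>M) - m\<^sup>2"
    using assms by (simp add: prob_space m_def[symmetric] power2_eq_square)
  finally show ?thesis by (simp add: m_def)
qed

subsection \<open>Exchanging coordinates of independent points of the cube\<close>

text \<open>For fixed \<open>x\<close>, integrating over \<open>y\<close> averages out every
  coordinate but the \<open>k\<close>-th. Taking a full second point avoids splitting the space into
  one coordinate and the remaining ones.\<close>

definition mix :: "'d \<Rightarrow> real^'d \<Rightarrow> real^'d \<Rightarrow> real^'d" where
  "mix k x y = (\<chi> j. if j = k then x $ j else y $ j)"

text \<open>The second component is \<open>mix\<close>, so invariance of the product measure under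
  this map also yields the distribution of \<open>mix\<close>.\<close>

definition swap_coord :: "'d \<Rightarrow> (real^'d) \<times> (real^'d) \<Rightarrow> (real^'d) \<times> (real^'d)" where
  "swap_coord k p = (mix k (snd p) (fst p), mix k (fst p) (snd p))"

lemma mix_nth [simp]: "mix k x y $ j = (if j = k then x $ j else y $ j)"
  by (simp add: mix_def)

lemma swap_coord_swap_coord [simp]: "swap_coord k (swap_coord k p) = p"
  by (simp add: swap_coord_def prod_eq_iff vec_eq_iff)

lemma continuous_on_mix: "continuous_on A (\<lambda>p. mix k (fst p) (snd p))"
  "continuous_on A (\<lambda>p. mix k (snd p) (fst p))"
proof -
  \<comment> \<open>The conditional depends on the index only, so each component is a single
    coordinate map.\<close>
  have "continuous_on A (\<lambda>p::(real^'a)\<times>(real^'a). if j = k then fst p $ j else snd p $ j)"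
    "continuous_on A (\<lambda>p::(real^'a)\<times>(real^'a). if j = k then snd p $ j else fst p $ j)" for j
    by (cases "j = k"; simp; intro continuous_intros)+
  then show "continuous_on A (\<lambda>p. mix k (fst p) (snd p))"
    "continuous_on A (\<lambda>p. mix k (snd p) (fst p))"
    unfolding mix_def by (auto intro!: continuous_on_vec_lambda)
qed

lemma measurable_mix [measurable]:
  fixes k :: "'d::finite"
  shows "(\<lambda>p. mix k (fst p) (snd p)) \<in> borel \<Otimes>\<^sub>M borel \<rightarrow>\<^sub>M borel"
  using borel_measurable_continuous_onI[OF continuous_on_mix(1)[of UNIV k]] by (simp add: borel_prod)

lemma measurable_mix_snd [measurable]:
  fixes x :: "real^'d::finite"
  shows "mix k x \<in> borel \<rightarrow>\<^sub>M borel"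
proof -
  have "continuous_on UNIV (\<lambda>y. if j = k then x $ j else y $ j)" for j
    by (cases "j = k"; simp; intro continuous_intros)
  then show ?thesis
    unfolding mix_def by (intro borel_measurable_continuous_onI continuous_on_vec_lambda)
qed

lemma measurable_swap_coord [measurable]:
  fixes k :: "'d::finite"
  shows "swap_coord k \<in> borel \<Otimes>\<^sub>M borel \<rightarrow>\<^sub>M borel \<Otimes>\<^sub>M borel"
proof -
  have "continuous_on UNIV (swap_coord k)"
    unfolding swap_coord_def by (intro continuous_intros continuous_on_mix)
  then show ?thesis by (simp add: borel_prod borel_measurable_continuous_onI)
qed

section \<open>Volumes of boxes in coordinates\<close>

lemma prod_Basis_cart: "(\<Prod>b\<in>(Basis::(real^'d::finite) set). f b) = (\<Prod>j\<in>UNIV. f (axis j 1))"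
proof -
  have Basis: "(Basis :: (real^'d) set) = range (\<lambda>j. axis j 1)"
    by (auto simp: Basis_vec_def)
  have "inj (\<lambda>j::'d. axis j (1::real))"
    by (auto simp: inj_def axis_eq_axis)
  then show ?thesis
    unfolding Basis by (subst prod.reindex) (simp_all add: o_def)
qed

lemma emeasure_lborel_box_cart:
  fixes l u :: "real^'d::finite"
  assumes "\<And>j. l $ j \<le> u $ j"
  shows "emeasure lborel (box l u) = ennreal (\<Prod>j\<in>UNIV. (u - l) $ j)"
proof -
  have "emeasure lborel (box l u) = ennreal (\<Prod>b\<in>Basis. (u - l) \<bullet> b)"
    using assms by (intro emeasure_lborel_box) (auto simp: Basis_vec_def inner_axis)
  then show ?thesis
    by (simp only: prod_Basis_cart inner_axis inner_real_def mult_1_right)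
qed

lemma box_Times:
  fixes a b :: "'a::euclidean_space \<times> 'b::euclidean_space"
  shows "box a b = box (fst a) (fst b) \<times> box (snd a) (snd b)"
  by (cases a; cases b) (auto simp: box_def Basis_prod_def ball_Un)

lemma emeasure_lborel_box_Times:
  fixes a b c d :: "real^'d::finite"
  assumes "\<And>j. a $ j \<le> b $ j" "\<And>j. c $ j \<le> d $ j"
  shows "emeasure lborel (box (a, c) (b, d)) = ennreal (\<Prod>j\<in>UNIV. (b - a) $ j * (d - c) $ j)"
proof -
  have "emeasure lborel (box (a, c) (b, d)) = emeasure lborel (box a b) * emeasure lborel (box c d)"
    by (simp add: box_Times lborel_prod[symmetric] lborel.emeasure_pair_measure_Times del: lborel_prod)
  also have "\<dots> = ennreal (\<Prod>j\<in>UNIV. (b - a) $ j * (d - c) $ j)"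
    using assms by (simp add: emeasure_lborel_box_cart ennreal_mult'[symmetric] prod_nonneg prod.distrib)
  finally show ?thesis .
qed

lemma in_Basis_prod:
  fixes j :: "'d::finite"
  shows "(axis j (1::real), 0::'b::euclidean_space) \<in> Basis" "(0::'b, axis j (1::real)) \<in> Basis"
  by (simp_all add: Basis_prod_def)

text \<open>Lebesgue measure is determined by its values on boxes, and the swap turns a box into the
  box with the two \<open>k\<close>-th sides exchanged, which has the same volume.\<close>

lemma distr_swap_coord_lborel:
  fixes k :: "'d::finite"
  shows "distr lborel lborel (swap_coord k) = (lborel :: ((real^'d) \<times> (real^'d)) measure)"
proof (rule sym, rule lborel_eqI)
  have m: "swap_coord k \<in> borel \<rightarrow>\<^sub>M borel"
    using measurable_swap_coord[of k] by (simp add: borel_prod)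
  fix l u :: "(real^'d) \<times> (real^'d)"
  assume le: "\<And>b. b \<in> Basis \<Longrightarrow> l \<bullet> b \<le> u \<bullet> b"
  have le1: "fst l $ j \<le> fst u $ j" for j
    using le[of "(axis j 1, 0)"] by (simp add: in_Basis_prod inner_prod_def inner_axis)
  have le2: "snd l $ j \<le> snd u $ j" for j
    using le[of "(0, axis j 1)"] by (simp add: in_Basis_prod inner_prod_def inner_axis)
  \<comment> \<open>The map is an involution that permutes coordinates, so the preimage of a box is
    found by applying it to the two corners.\<close>
  have "swap_coord k -` box l u = box (swap_coord k l) (swap_coord k u)"
    by (auto simp: box_Times swap_coord_def mem_box_cart split: if_splits)
  then have "emeasure (distr lborel lborel (swap_coord k)) (box l u)
      = emeasure lborel (box (swap_coord k l) (swap_coord k u))"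
    using m by (subst emeasure_distr) auto
  also have "\<dots> = ennreal (\<Prod>j\<in>UNIV. (fst (swap_coord k u) - fst (swap_coord k l)) $ j *
      (snd (swap_coord k u) - snd (swap_coord k l)) $ j)"
    using le1 le2 by (subst emeasure_lborel_box_Times[symmetric]) (auto simp: swap_coord_def)
  \<comment> \<open>Only the factor at index \<open>k\<close> changes, and there the two side
    lengths trade places.\<close>
  also have "\<dots> = ennreal (\<Prod>j\<in>UNIV. (fst u - fst l) $ j * (snd u - snd l) $ j)"
    by (intro arg_cong[where f=ennreal] prod.cong) (auto simp: swap_coord_def)
  also have "\<dots> = emeasure lborel (box l u)"
    using le1 le2 emeasure_lborel_box_Times[of "fst l" "fst u" "snd l" "snd u"] by simp
  finally show "emeasure (distr lborel lborel (swap_coord k)) (box l u) = (\<Prod>b\<in>Basis. (u - l) \<bullet> b)"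
    using le by simp
qed simp

text \<open>The uniform distribution on the cube, on Borel sets: continuous maps such as
  \<open>mix\<close> are then measurable on the product and Fubini's theorem applies to them. Using
  a density instead of a restriction keeps the whole space as carrier, so measurability is plain
  Borel measurability.\<close>

definition cube_borel :: "(real^'d::finite) measure" where
  "cube_borel = density lborel (\<lambda>x. ennreal (indicator (cbox 0 1) x))"

lemma sets_cube_borel [simp, measurable_cong]: "sets cube_borel = sets borel"
  by (simp add: cube_borel_def)

lemma space_cube_borel [simp]: "space cube_borel = UNIV"
  by (simp add: cube_borel_def)

lemma prob_space_cube_borel: "prob_space (cube_borel :: (real^'d::finite) measure)"
proof
  have "(\<Prod>b\<in>Basis. (1 - 0 :: real^'d) \<bullet> b) = 1"
    by (simp only: prod_Basis_cart inner_axis) simp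
  then have "emeasure lborel (cbox 0 (1::real^'d)) = 1"
    by (subst emeasure_lborel_cbox) (auto simp: Basis_vec_def inner_axis)
  then show "emeasure cube_borel (space (cube_borel :: (real^'d) measure)) = 1"
    by (simp add: cube_borel_def emeasure_density ennreal_indicator)
qed

lemma borel_measurable_cube_borel [simp]: "borel_measurable cube_borel = borel_measurable borel"
  by (rule measurable_cong_sets) simp_all

interpretation cube: prob_space "cube_borel :: (real^'d::finite) measure"
  by (rule prob_space_cube_borel)

interpretation cube2: pair_prob_space "cube_borel :: (real^'d::finite) measure" "cube_borel :: (real^'d::finite) measure"
  ..

lemma prob_UNIV_cube_borel [simp]: "measure cube_borel UNIV = 1"
  using cube.prob_space by simp

lemma emeasure_UNIV_cube_borel [simp]: "emeasure cube_borel UNIV = 1"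
  using cube.emeasure_space_1 by simp

text \<open>Lebesgue measure on pairs is invariant, and so is the density, because lying in the cube
  is a condition on each coordinate separately.\<close>

lemma distr_swap_coord:
  fixes k :: "'d::finite"
  defines "N \<equiv> cube_borel \<Otimes>\<^sub>M (cube_borel :: (real^'d) measure)"
  shows "distr N N (swap_coord k) = N"
proof -
  let ?\<phi> = "\<lambda>p::(real^'d) \<times> (real^'d). ennreal (indicator (cbox 0 1) (fst p)) * ennreal (indicator (cbox 0 1) (snd p))"
  have N: "N = density lborel ?\<phi>"
    unfolding N_def cube_borel_def
    by (subst pair_measure_density)
      (auto simp: lborel_prod lborel.sigma_finite_measure_axioms case_prod_beta'
        prob_space_imp_sigma_finite[OF prob_space_cube_borel, unfolded cube_borel_def])
  have m: "swap_coord k \<in> borel \<rightarrow>\<^sub>M borel" "?\<phi> \<in> borel_measurable borel"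
    using measurable_swap_coord[of k] by (simp_all add: borel_prod[symmetric])
  have inv: "?\<phi> (swap_coord k p) = ?\<phi> p" for p
    by (auto simp: swap_coord_def mem_box_cart indicator_def split: if_splits; metis)
  \<comment> \<open>Invariance writes the density as a composition with the swap, which
    \<open>density_distr\<close> can move outside the image measure.\<close>
  have "distr N N (swap_coord k) = distr (density lborel (\<lambda>p. ?\<phi> (swap_coord k p))) lborel (swap_coord k)"
    unfolding N inv by (intro distr_cong) auto
  also have "\<dots> = density (distr lborel lborel (swap_coord k)) ?\<phi>"
    using m by (subst density_distr) auto
  finally show ?thesis by (simp only: distr_swap_coord_lborel N)
qed

subsection \<open>Coordinate and additive means\<close>

lemma sq_integrable_distr:
  assumes "T \<in> N \<rightarrow>\<^sub>M M" "distr N M T = M" "sq_integrable M f"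
  shows "sq_integrable N (\<lambda>p. f (T p))"
proof -
  have "integrable (distr N M T) (\<lambda>x. (f x)\<^sup>2)" "f \<in> borel_measurable M"
    using assms by (simp_all add: sq_integrable_def)
  then show ?thesis
    using assms(1) by (auto simp: sq_integrable_def integrable_distr_eq intro: measurable_compose)
qed

lemma distr_fst_cube:
  "distr (cube_borel \<Otimes>\<^sub>M (cube_borel :: (real^'d::finite) measure)) cube_borel fst = (cube_borel :: (real^'d) measure)"
  by (rule cube.distr_pair_fst)

lemma distr_snd_cube:
  "distr ((cube_borel :: (real^'d) measure) \<Otimes>\<^sub>M (cube_borel :: (real^'d::finite) measure)) cube_borel snd = (cube_borel :: (real^'d) measure)"
proof (rule measure_eqI)
  let ?N = "(cube_borel :: (real^'d) measure) \<Otimes>\<^sub>M (cube_borel :: (real^'d) measure)"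
  fix A assume "A \<in> sets (distr ?N (cube_borel :: (real^'d) measure) snd)"
  then have A: "A \<in> sets (cube_borel :: (real^'d) measure)" by simp
  have "snd -` A \<inter> space ?N = (UNIV :: (real^'d) set) \<times> A"
    by (auto simp: space_pair_measure)
  then show "emeasure (distr ?N cube_borel snd) A = emeasure (cube_borel :: (real^'d) measure) A"
    using A cube.emeasure_pair_measure_Times[of UNIV "cube_borel :: (real^'d) measure" A]
    by (subst emeasure_distr) auto
qed simp

lemma distr_mix:
  fixes k :: "'d::finite"
  shows "distr (cube_borel \<Otimes>\<^sub>M cube_borel) cube_borel (\<lambda>p. mix k (fst p) (snd p)) = cube_borel"
proof -
  let ?N = "(cube_borel :: (real^'d) measure) \<Otimes>\<^sub>M (cube_borel :: (real^'d) measure)"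
  have "distr ?N cube_borel (\<lambda>p. mix k (fst p) (snd p)) = distr (distr ?N ?N (swap_coord k)) cube_borel snd"
    by (subst distr_distr) (auto simp: swap_coord_def o_def intro!: distr_cong)
  then show ?thesis
    by (simp only: distr_swap_coord distr_snd_cube)
qed

text \<open>For square-integrable \<open>f\<close>, a version of the conditional expectation given
  the \<open>k\<close>-th coordinate under the uniform distribution. It depends on that coordinate
  at every point, without an exceptional null set.\<close>

definition coord_mean :: "'d::finite \<Rightarrow> (real^'d \<Rightarrow> real) \<Rightarrow> real^'d \<Rightarrow> real" where
  "coord_mean k f x = (\<integral>y. f (mix k x y) \<partial>cube_borel)"

lemma coord_mean_cong: "x $ k = y $ k \<Longrightarrow> coord_mean k f x = coord_mean k f y"
proof -
  assume "x $ k = y $ k"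
  then have "mix k x z = mix k y z" for z
    by (simp add: vec_eq_iff)
  then show ?thesis by (simp add: coord_mean_def)
qed

lemma coord_mean_eq_fun: "\<exists>g. \<forall>x. coord_mean k f x = g (x $ k)"
proof (intro exI allI)
  \<comment> \<open>The univariate function is the coordinate mean along the diagonal: any vector
    with the right \<open>k\<close>-th entry would do, and a constant vector is one.\<close>
  fix x show "coord_mean k f x = coord_mean k f (\<chi> j. x $ k)"
    by (rule coord_mean_cong) simp
qed

lemma sq_integrable_mix:
  "sq_integrable cube_borel f \<Longrightarrow> sq_integrable (cube_borel \<Otimes>\<^sub>M cube_borel) (\<lambda>p. f (mix k (fst p) (snd p)))"
  by (rule sq_integrable_distr[OF _ distr_mix]) measurable

lemma AE_integrable_mix:
  assumes "sq_integrable cube_borel f"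
  shows "AE x in cube_borel. integrable cube_borel (\<lambda>y. f (mix k x y))"
    and "AE x in cube_borel. integrable cube_borel (\<lambda>y. (f (mix k x y))\<^sup>2)"
  using cube2.AE_integrable_fst'[OF cube2.P.sq_integrable_integrable[OF sq_integrable_mix[OF assms]], of k]
    cube2.AE_integrable_fst'[of "\<lambda>p. (f (mix k (fst p) (snd p)))\<^sup>2"] sq_integrable_mix[OF assms, of k]
  by (simp_all add: sq_integrable_def)

lemma measurable_coord_mean:
  assumes "f \<in> borel_measurable borel"
  shows "coord_mean k f \<in> borel_measurable cube_borel"
proof -
  have [measurable]: "f \<in> borel_measurable borel" by fact
  have "(\<lambda>p. f (mix k (fst p) (snd p))) \<in> borel_measurable (cube_borel \<Otimes>\<^sub>M cube_borel)"
    by measurable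
  then show ?thesis
    unfolding coord_mean_def[abs_def]
    by (intro cube.borel_measurable_lebesgue_integral) (simp add: case_prod_beta')
qed

text \<open>The square of the mean is at most the mean of the square, which is integrable by
  Fubini's theorem.\<close>

lemma sq_integrable_coord_mean:
  assumes f: "sq_integrable cube_borel f"
  shows "sq_integrable cube_borel (coord_mean k f)"
  unfolding sq_integrable_def
proof
  have "f \<in> borel_measurable borel"
    using f by (simp add: sq_integrable_def)
  then show m [measurable]: "coord_mean k f \<in> borel_measurable cube_borel"
    by (rule measurable_coord_mean)
  show "integrable cube_borel (\<lambda>x. (coord_mean k f x)\<^sup>2)"
  proof (rule Bochner_Integration.integrable_bound)
    show "integrable cube_borel (\<lambda>x. \<integral>y. (f (mix k x y))\<^sup>2 \<partial>cube_borel)"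
      using cube2.integrable_fst'[of "\<lambda>p. (f (mix k (fst p) (snd p)))\<^sup>2"] sq_integrable_mix[OF f, of k]
      by (simp add: sq_integrable_def)
    show "AE x in cube_borel. norm ((coord_mean k f x)\<^sup>2) \<le> norm (\<integral>y. (f (mix k x y))\<^sup>2 \<partial>cube_borel)"
      using AE_integrable_mix[OF f, of k]
      by eventually_elim (simp add: coord_mean_def cube.square_integral_le)
  qed measurable
qed

text \<open>Both sides are integrals over pairs of points. Swapping the \<open>k\<close>-th
  coordinates turns \<open>f (mix k x y) * t x\<close> into \<open>f y * t (mix k y x)\<close> and
  preserves the product measure.\<close>

lemma coord_mean_symmetric:
  assumes f: "sq_integrable cube_borel f" and t: "sq_integrable cube_borel t"
  shows "(\<integral>x. coord_mean k f x * t x \<partial>cube_borel) = (\<integral>x. f x * coord_mean k t x \<partial>cube_borel)"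
proof -
  let ?N = "cube_borel \<Otimes>\<^sub>M (cube_borel :: (real^'a) measure)"
  have [measurable]: "f \<in> borel_measurable borel" "t \<in> borel_measurable borel"
    using f t by (simp_all add: sq_integrable_def)
  have int1: "integrable ?N (\<lambda>p. f (mix k (fst p) (snd p)) * t (fst p))"
    using sq_integrable_mix[OF f] sq_integrable_distr[OF _ distr_fst_cube t]
    by (intro sq_integrable_mult_integrable) auto
  have G[measurable]: "(\<lambda>p. f (snd p) * t (fst (swap_coord k p))) \<in> borel_measurable ?N"
    by measurable
  \<comment> \<open>Inserting the swap twice exhibits the integrand as a function composed with
    \<open>swap_coord k\<close>, as the change of variables requires.\<close>
  have eq: "f (mix k (fst p) (snd p)) * t (fst p)
      = f (snd (swap_coord k p)) * t (fst (swap_coord k (swap_coord k p)))" for p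
    by (simp only: swap_coord_swap_coord) (simp add: swap_coord_def)
  have sw: "swap_coord k \<in> ?N \<rightarrow>\<^sub>M ?N" by measurable
  have int2: "integrable ?N (\<lambda>p. f (snd p) * t (fst (swap_coord k p)))"
    using int1 unfolding eq integrable_distr_eq[OF sw G, symmetric] distr_swap_coord .
  have "(\<integral>x. coord_mean k f x * t x \<partial>cube_borel)
      = (\<integral>x. (\<integral>y. f (mix k x y) * t x \<partial>cube_borel) \<partial>cube_borel)"
    by (simp add: coord_mean_def)
  also have "\<dots> = (\<integral>p. f (mix k (fst p) (snd p)) * t (fst p) \<partial>?N)"
    using cube2.integral_fst'[OF int1] by simp
  also have "\<dots> = (\<integral>p. f (snd p) * t (fst (swap_coord k p)) \<partial>distr ?N ?N (swap_coord k))"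
    unfolding eq integral_distr[OF sw G] ..
  also have "\<dots> = (\<integral>p. f (snd p) * t (mix k (snd p) (fst p)) \<partial>?N)"
    unfolding distr_swap_coord by (simp add: swap_coord_def)
  also have "\<dots> = (\<integral>y. (\<integral>x. f y * t (mix k y x) \<partial>cube_borel) \<partial>cube_borel)"
  proof (rule cube2.integral_snd[of "\<lambda>x y. f y * t (mix k y x)", unfolded case_prod_beta', symmetric])
    show "integrable ?N (\<lambda>p. f (snd p) * t (mix k (snd p) (fst p)))"
      using int2 by (simp add: swap_coord_def)
  qed
  also have "\<dots> = (\<integral>x. f x * coord_mean k t x \<partial>cube_borel)"
    by (simp add: coord_mean_def)
  finally show ?thesis .
qed

text \<open>Both projections and each \<open>mix k\<close> carry the product measure to the uniform
  distribution, so they pull null sets back to null sets. This allows an almost sure identity to be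
  used at \<open>x\<close>, \<open>y\<close> and all mixed points at once.\<close>

lemma AE_cube_borel_pair:
  assumes "AE x in (cube_borel :: (real^'d::finite) measure). P x"
  shows "AE x in cube_borel. AE y in cube_borel. P x \<and> P y \<and> (\<forall>k. P (mix k x y))"
proof -
  let ?N = "(cube_borel :: (real^'d) measure) \<Otimes>\<^sub>M (cube_borel :: (real^'d) measure)"
  have 1: "AE p in ?N. P (fst p)"
    by (rule AE_distrD[OF measurable_fst]) (simp only: distr_fst_cube assms)
  have 2: "AE p in ?N. P (snd p)"
    by (rule AE_distrD[OF measurable_snd]) (simp only: distr_snd_cube assms)
  have 3: "AE p in ?N. P (mix k (fst p) (snd p))" for k
  proof -
    have m: "(\<lambda>p. mix k (fst p) (snd p)) \<in> ?N \<rightarrow>\<^sub>M cube_borel"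
      using measurable_mix[of k] by (subst measurable_cong_sets[OF sets_pair_measure_cong]) auto
    show ?thesis by (rule AE_distrD[OF m, where P = P]) (simp only: distr_mix assms)
  qed
  have "AE p in ?N. P (fst p) \<and> P (snd p) \<and> (\<forall>k. P (mix k (fst p) (snd p)))"
    using 1 2 3 by (simp add: AE_all_countable)
  from cube2.AE_pair[OF this] show ?thesis by simp
qed

text \<open>For almost every \<open>x\<close>, the values \<open>t (mix k x y)\<close> and
  \<open>t x\<close> both equal \<open>g (x $ k)\<close> for almost all \<open>y\<close>, so a
  constant is averaged.\<close>

lemma coord_mean_of_coord_fun:
  assumes t: "sq_integrable cube_borel t" and g: "AE x in cube_borel. t x = g (x $ k)"
  shows "AE x in cube_borel. coord_mean k t x = t x"
  using AE_cube_borel_pair[OF g]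
proof eventually_elim
  case (elim x)
  have "AE y in cube_borel. t (mix k x y) = t x"
    using elim by eventually_elim (metis mix_nth)
  then have "coord_mean k t x = (\<integral>y. t x \<partial>(cube_borel :: (real^'a) measure))"
    unfolding coord_mean_def using sq_integrable_measurable[OF t]
    by (intro integral_cong_AE) auto
  then show ?case by simp
qed

text \<open>The grand mean plus the main effects of the Hoeffding (ANOVA) decomposition:
  \<open>E + (\<Sum>k. E\<^sub>k - E)\<close>, with the means collected.\<close>

definition additive_mean :: "(real^'d::finite \<Rightarrow> real) \<Rightarrow> real^'d \<Rightarrow> real" where
  "additive_mean f x = (\<Sum>k\<in>UNIV. coord_mean k f x) - (real CARD('d) - 1) * (\<integral>y. f y \<partial>cube_borel)"

lemma sq_integrable_additive_mean:
  "sq_integrable cube_borel f \<Longrightarrow> sq_integrable cube_borel (additive_mean f)"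
  unfolding additive_mean_def
  by (intro sq_integrable_diff sq_integrable_sum sq_integrable_coord_mean cube.sq_integrable_const)

lemma additive_mean_symmetric:
  assumes f: "sq_integrable cube_borel f" and t: "sq_integrable cube_borel t"
  shows "(\<integral>x. additive_mean f x * t x \<partial>cube_borel) = (\<integral>x. f x * additive_mean t x \<partial>cube_borel)"
proof -
  let ?c = "real CARD('a) - 1"
  note int = sq_integrable_mult_integrable[OF sq_integrable_coord_mean[OF f] t]
    sq_integrable_mult_integrable[OF f sq_integrable_coord_mean[OF t]]
    cube.sq_integrable_integrable[OF f] cube.sq_integrable_integrable[OF t]
  have "(\<integral>x. additive_mean f x * t x \<partial>cube_borel) =
      (\<integral>x. (\<Sum>k\<in>UNIV. coord_mean k f x * t x) - ?c * (\<integral>y. f y \<partial>cube_borel) * t x \<partial>cube_borel)"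
    by (simp add: additive_mean_def left_diff_distrib sum_distrib_right)
  also have "\<dots> = (\<Sum>k\<in>UNIV. \<integral>x. coord_mean k f x * t x \<partial>cube_borel)
      - ?c * (\<integral>y. f y \<partial>cube_borel) * (\<integral>y. t y \<partial>cube_borel)"
    using int by simp
  also have "\<dots> = (\<Sum>k\<in>UNIV. \<integral>x. f x * coord_mean k t x \<partial>cube_borel)
      - ?c * (\<integral>y. t y \<partial>cube_borel) * (\<integral>y. f y \<partial>cube_borel)"
    using coord_mean_symmetric[OF f t] by simp
  also have "\<dots> = (\<integral>x. (\<Sum>k\<in>UNIV. f x * coord_mean k t x) - ?c * (\<integral>y. t y \<partial>cube_borel) * f x \<partial>cube_borel)"
    using int by simp
  also have "\<dots> = (\<integral>x. f x * additive_mean t x \<partial>cube_borel)"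
    by (simp add: additive_mean_def right_diff_distrib sum_distrib_left algebra_simps)
  finally show ?thesis .
qed

text \<open>The \<open>f k\<close> carry no measurability and cannot be integrated one by one.
  Instead they are eliminated pointwise, leaving an identity between values of \<open>t\<close> that
  is then integrated over \<open>y\<close>.\<close>

lemma additive_mean_of_additive:
  fixes t :: "real^'d::finite \<Rightarrow> real"
  assumes t: "sq_integrable cube_borel t" and f: "AE x in cube_borel. t x = (\<Sum>k\<in>UNIV. f k (x $ k))"
  shows "AE x in cube_borel. additive_mean t x = t x"
proof -
  have "AE x in cube_borel. \<forall>k. integrable cube_borel (\<lambda>y. t (mix k x y))"
    using AE_integrable_mix(1)[OF t] by (simp add: AE_all_countable)
  with AE_cube_borel_pair[OF f] show ?thesis
  proof eventually_elim
    case (elim x)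
    have int: "integrable cube_borel (\<lambda>y. (\<Sum>k\<in>UNIV. t (mix k x y)) - (real CARD('d) - 1) * t y)"
      using elim cube.sq_integrable_integrable[OF t] by auto
    have "AE y in cube_borel. (\<Sum>k\<in>UNIV. t (mix k x y)) - (real CARD('d) - 1) * t y = t x"
      using elim(1)
    proof eventually_elim
      case (elim y)
      have "t (mix k x y) = t y - f k (y $ k) + f k (x $ k)" for k
      proof -
        have "t (mix k x y) = (\<Sum>j\<in>UNIV. f j (y $ j) + (if j = k then f k (x $ k) - f k (y $ k) else 0))"
          using elim by (auto intro!: sum.cong)
        then show ?thesis using elim by (simp add: sum.distrib)
      qed
      \<comment> \<open>Summing the single exchanges over \<open>k\<close> reassembles all of
        \<open>t y\<close> and all of \<open>t x\<close>.\<close>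
      then have "(\<Sum>k\<in>UNIV. t (mix k x y)) = real CARD('d) * t y - t y + t x"
        using elim by (simp add: sum.distrib sum_subtractf)
      then show ?case by (simp add: left_diff_distrib)
    qed
    then have "(\<integral>y. (\<Sum>k\<in>UNIV. t (mix k x y)) - (real CARD('d) - 1) * t y \<partial>cube_borel)
        = (\<integral>y. t x \<partial>(cube_borel :: (real^'d) measure))"
      using int by (intro integral_cong_AE) auto
    then show ?case
      using elim cube.sq_integrable_integrable[OF t]
      by (simp add: additive_mean_def coord_mean_def)
  qed
qed

subsection \<open>Orthogonal projection onto the additive tuples\<close>

lemma AE_cube_measure_iff: "(AE x in cube_measure. P x) \<longleftrightarrow> (AE x in cube_borel. P x)"
proof -
  have "(AE x in cube_measure. P x) \<longleftrightarrow> (AE x in lebesgue. x \<in> cbox 0 1 \<longrightarrow> P x)"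
    unfolding cube_measure_def by (rule AE_restrict_space_iff) simp
  also have "\<dots> \<longleftrightarrow> (AE x in cube_borel. P x)"
    unfolding cube_borel_def by (subst AE_density) (auto simp: AE_completion_iff indicator_def)
  finally show ?thesis .
qed

lemma measurable_cube_measure_borel:
  "f \<in> borel_measurable borel \<Longrightarrow> f \<in> borel_measurable cube_measure"
  unfolding cube_measure_def
  by (intro measurable_restrict_space1 measurable_completion) simp

lemma integrable_cube_measure_iff:
  fixes f :: "real^'d::finite \<Rightarrow> real"
  assumes "f \<in> borel_measurable borel"
  shows "integrable cube_measure f \<longleftrightarrow> integrable cube_borel f"
  using assms unfolding cube_measure_def cube_borel_def
  by (subst integrable_density) (auto simp: integrable_restrict_space integrable_completion)

lemma integral_cube_measure:
  fixes f :: "real^'d::finite \<Rightarrow> real"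
  assumes "f \<in> borel_measurable borel"
  shows "integral\<^sup>L cube_measure f = integral\<^sup>L cube_borel f"
  using assms unfolding cube_measure_def cube_borel_def
  by (subst integral_density) (auto simp: integral_restrict_space integral_completion)

lemma cube_measure_borel_representative:
  fixes f :: "real^'d::finite \<Rightarrow> real"
  assumes "f \<in> borel_measurable cube_measure"
  obtains g where "g \<in> borel_measurable borel" "AE x in cube_measure. f x = g x"
proof -
  \<comment> \<open>The indicator extends \<open>f\<close> by zero to the whole space, where
    functions measurable for the completion have Borel versions.\<close>
  have "(\<lambda>x. f x * indicator (cbox 0 1) x) \<in> borel_measurable (completion lborel)"
    using assms unfolding cube_measure_def
    by (subst (asm) borel_measurable_restrict_space_iff) (auto simp: mult.commute)
  then obtain g where g: "g \<in> borel_measurable lborel"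
    "AE x in lborel. f x * indicator (cbox 0 1) x = g x"
    using completion_ex_borel_measurable_real by blast
  have "AE x in cube_measure. f x = g x"
    unfolding AE_cube_measure_iff cube_borel_def
    using g by (subst AE_density) (auto simp: indicator_def elim!: eventually_mono split: if_splits)
  with g(1) that show ?thesis by simp
qed

lemma sq_integrable_cube_borel_iff:
  assumes "f \<in> borel_measurable borel"
  shows "sq_integrable cube_measure f \<longleftrightarrow> sq_integrable cube_borel f"
  using assms measurable_cube_measure_borel[OF assms]
  by (simp add: sq_integrable_def integrable_cube_measure_iff)

lemma sq_integrable_cong_AE:
  assumes "sq_integrable M f" "g \<in> borel_measurable M" "AE x in M. f x = g x"
  shows "sq_integrable M g"
proof -
  have [measurable]: "f \<in> borel_measurable M" "g \<in> borel_measurable M"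
    using assms by (simp_all add: sq_integrable_def)
  have "integrable M (\<lambda>x. (f x)\<^sup>2) \<longleftrightarrow> integrable M (\<lambda>x. (g x)\<^sup>2)"
    using assms(3) by (intro integrable_cong_AE) (measurable, auto)
  then show ?thesis using assms by (simp add: sq_integrable_def)
qed

lemma cube_measure_sq_integrable_representative:
  assumes "sq_integrable cube_measure f"
  obtains g where "sq_integrable cube_borel g" "sq_integrable cube_measure g"
    "AE x in cube_measure. f x = g x"
proof -
  obtain g where g: "g \<in> borel_measurable borel" "AE x in cube_measure. f x = g x"
    using cube_measure_borel_representative[OF sq_integrable_measurable[OF assms]] .
  then have "sq_integrable cube_measure g"
    using assms measurable_cube_measure_borel by (blast intro: sq_integrable_cong_AE)
  with g that show ?thesis by (simp add: sq_integrable_cube_borel_iff)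
qed

text \<open>A symmetric operator with range in \<open>C\<close> that fixes \<open>C\<close> is the
  orthogonal projection: the inner product of \<open>f - A f\<close> with \<open>t\<close> is that
  of \<open>f\<close> with \<open>t - A t\<close>, which vanishes. The operator acts on a Borel
  version of \<open>f\<close>; \<open>C_AE\<close> transfers membership to a Borel version of
  \<open>t\<close>.\<close>

lemma projection_of_symmetric_operator:
  fixes A :: "(real^'d::finite \<Rightarrow> real) \<Rightarrow> real^'d \<Rightarrow> real" and C :: "(real^'d \<Rightarrow> real) \<Rightarrow> bool"
  assumes sq: "\<And>f. sq_integrable cube_borel f \<Longrightarrow> sq_integrable cube_borel (A f)"
    and sym: "\<And>f t. sq_integrable cube_borel f \<Longrightarrow> sq_integrable cube_borel t \<Longrightarrow>
      (\<integral>x. A f x * t x \<partial>cube_borel) = (\<integral>x. f x * A t x \<partial>cube_borel)"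
    and C: "\<And>f. C (A f)"
    and fixed: "\<And>t. sq_integrable cube_borel t \<Longrightarrow> C t \<Longrightarrow> AE x in cube_borel. A t x = t x"
    and C_AE: "\<And>s t. C s \<Longrightarrow> AE x in cube_measure. s x = t x \<Longrightarrow> C t"
    and f: "sq_integrable cube_measure f"
  shows "\<exists>p. sq_integrable cube_measure p \<and> C p \<and>
    (\<forall>t. sq_integrable cube_measure t \<and> C t \<longrightarrow> (\<integral>x. (f x - p x) * t x \<partial>cube_measure) = 0)"
proof -
  obtain f' where f': "sq_integrable cube_borel f'" "sq_integrable cube_measure f'"
      "AE x in cube_measure. f x = f' x"
    using cube_measure_sq_integrable_representative[OF f] .
  have Af': "sq_integrable cube_measure (A f')"
    using sq[OF f'(1)] sq_integrable_cube_borel_iff sq_integrable_measurable by fastforce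
  have "(\<integral>x. (f x - A f' x) * t x \<partial>cube_measure) = 0"
    if t: "sq_integrable cube_measure t" "C t" for t
  proof -
    obtain t' where t': "sq_integrable cube_borel t'" "sq_integrable cube_measure t'"
      "AE x in cube_measure. t x = t' x"
      using cube_measure_sq_integrable_representative[OF t(1)] .
    note [measurable] = sq_integrable_measurable[OF f] sq_integrable_measurable[OF t(1)]
      sq_integrable_measurable[OF f'(2)] sq_integrable_measurable[OF t'(2)]
      sq_integrable_measurable[OF Af']
    have b: "f' \<in> borel_measurable borel" "t' \<in> borel_measurable borel"
      "A f' \<in> borel_measurable borel" "A t' \<in> borel_measurable borel"
      using f'(1) t'(1) sq[OF f'(1)] sq[OF t'(1)] sq_integrable_measurable by fastforce+
    have "(\<integral>x. (f x - A f' x) * t x \<partial>cube_measure) = (\<integral>x. (f' x - A f' x) * t' x \<partial>cube_measure)"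
      using f'(3) t'(3) by (intro integral_cong_AE) (measurable, auto)
    also have "\<dots> = (\<integral>x. f' x * t' x - A f' x * t' x \<partial>cube_borel)"
      using b by (subst integral_cube_measure) (auto simp: left_diff_distrib)
    also have "\<dots> = (\<integral>x. f' x * t' x \<partial>cube_borel) - (\<integral>x. A f' x * t' x \<partial>cube_borel)"
      using f'(1) t'(1) sq by (intro Bochner_Integration.integral_diff sq_integrable_mult_integrable) auto
    also have "(\<integral>x. A f' x * t' x \<partial>cube_borel) = (\<integral>x. f' x * A t' x \<partial>cube_borel)"
      by (rule sym[OF f'(1) t'(1)])
    also have "\<dots> = (\<integral>x. f' x * t' x \<partial>cube_borel)"
      using fixed[OF t'(1) C_AE[OF t(2) t'(3)]] b by (intro integral_cong_AE) auto
    finally show ?thesis by simp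
  qed
  with C Af' show ?thesis by blast
qed

lemma F_full_iff: "r \<in> F_full \<longleftrightarrow> (\<forall>l. sq_integrable cube_measure (\<lambda>x. r x $ l))"
  by (simp add: F_full_def sq_integrable_def)

lemma AE_eq_trans:
  assumes "AE x in M. s x = t x" "AE x in M. s x = g x"
  shows "AE x in M. t x = g x"
  using assms by eventually_elim simp

lemma additive_projection_exists:
  fixes f :: "real^'d::finite \<Rightarrow> real"
  assumes "sq_integrable cube_measure f"
  shows "\<exists>p. sq_integrable cube_measure p \<and>
    (\<exists>g. AE x in cube_measure. p x = (\<Sum>k\<in>UNIV. g k (x $ k))) \<and>
    (\<forall>t. sq_integrable cube_measure t \<and> (\<exists>g. AE x in cube_measure. t x = (\<Sum>k\<in>UNIV. g k (x $ k)))
      \<longrightarrow> (\<integral>x. (f x - p x) * t x \<partial>cube_measure) = 0)"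
proof (rule projection_of_symmetric_operator[where A = additive_mean])
  fix f :: "real^'d \<Rightarrow> real"
  obtain g where g: "\<And>k x. coord_mean k f x = g k (x $ k)"
    using coord_mean_eq_fun[of _ f] by metis
  \<comment> \<open>The constant is spread evenly over the coordinates, whose number is
    positive.\<close>
  define g' where "g' k u = g k u - (real CARD('d) - 1) * (\<integral>y. f y \<partial>cube_borel) / real CARD('d)" for k u
  have "additive_mean f x = (\<Sum>k\<in>UNIV. g' k (x $ k))" for x
    by (simp add: additive_mean_def g g'_def sum_subtractf)
  then show "\<exists>g. AE x in cube_measure. additive_mean f x = (\<Sum>k\<in>UNIV. g k (x $ k))"
    by auto
next
  fix t :: "real^'d \<Rightarrow> real"
  assume "sq_integrable cube_borel t" "\<exists>g. AE x in cube_measure. t x = (\<Sum>k\<in>UNIV. g k (x $ k))"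
  then show "AE x in cube_borel. additive_mean t x = t x"
    unfolding AE_cube_measure_iff by (blast intro: additive_mean_of_additive)
next
  fix s t :: "real^'d \<Rightarrow> real"
  assume "\<exists>g. AE x in cube_measure. s x = (\<Sum>k\<in>UNIV. g k (x $ k))"
    and st: "AE x in cube_measure. s x = t x"
  then show "\<exists>g. AE x in cube_measure. t x = (\<Sum>k\<in>UNIV. g k (x $ k))"
    by (elim exE) (rule exI, rule AE_eq_trans[OF st])
qed (use assms in \<open>simp_all add: sq_integrable_additive_mean additive_mean_symmetric\<close>)

lemma coordinate_projection_exists:
  fixes f :: "real^'d::finite \<Rightarrow> real"
  assumes "sq_integrable cube_measure f"
  shows "\<exists>p. sq_integrable cube_measure p \<and> (\<exists>g. AE x in cube_measure. p x = g (x $ k)) \<and>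
    (\<forall>t. sq_integrable cube_measure t \<and> (\<exists>g. AE x in cube_measure. t x = g (x $ k))
      \<longrightarrow> (\<integral>x. (f x - p x) * t x \<partial>cube_measure) = 0)"
proof (rule projection_of_symmetric_operator[where A = "coord_mean k"])
  fix f :: "real^'d \<Rightarrow> real"
  show "\<exists>g. AE x in cube_measure. coord_mean k f x = g (x $ k)"
    using coord_mean_eq_fun[of k f] by auto
next
  fix t :: "real^'d \<Rightarrow> real"
  assume "sq_integrable cube_borel t" "\<exists>g. AE x in cube_measure. t x = g (x $ k)"
  then show "AE x in cube_borel. coord_mean k t x = t x"
    unfolding AE_cube_measure_iff by (blast intro: coord_mean_of_coord_fun)
next
  fix s t :: "real^'d \<Rightarrow> real"
  assume "\<exists>g. AE x in cube_measure. s x = g (x $ k)"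
    and st: "AE x in cube_measure. s x = t x"
  then show "\<exists>g. AE x in cube_measure. t x = g (x $ k)"
    by (elim exE) (rule exI, rule AE_eq_trans[OF st])
qed (use assms in \<open>simp_all add: sq_integrable_coord_mean coord_mean_symmetric\<close>)

text \<open>The inner product is a sum over components and \<open>F_add\<close> constrains each
  component separately, so projecting the components one by one suffices.\<close>

lemma P_add_exists:
  fixes r :: "'d::finite fn_tuple"
  assumes "r \<in> F_full"
  shows "\<exists>s\<in>F_add. \<forall>t\<in>F_add. l2_inner (r - s) t = 0"
proof -
  have r: "sq_integrable cube_measure (\<lambda>x. r x $ l)" for l
    using assms by (simp add: F_full_iff)
  from additive_projection_exists[OF r[of None]] obtain p where p: "sq_integrable cube_measure p"
    "\<exists>g. AE x in cube_measure. p x = (\<Sum>k\<in>UNIV. g k (x $ k))"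
    "\<forall>t. sq_integrable cube_measure t \<and> (\<exists>g. AE x in cube_measure. t x = (\<Sum>k\<in>UNIV. g k (x $ k)))
      \<longrightarrow> (\<integral>x. (r x $ None - p x) * t x \<partial>cube_measure) = 0"
    by (rule exE) (elim conjE, rule that)
  have "\<forall>k. \<exists>q. sq_integrable cube_measure q \<and> (\<exists>g. AE x in cube_measure. q x = g (x $ k)) \<and>
    (\<forall>t. sq_integrable cube_measure t \<and> (\<exists>g. AE x in cube_measure. t x = g (x $ k))
      \<longrightarrow> (\<integral>x. (r x $ Some k - q x) * t x \<partial>cube_measure) = 0)"
    by (intro allI coordinate_projection_exists r)
  from choice[OF this] obtain q where q: "\<forall>k. sq_integrable cube_measure (q k) \<and>
    (\<exists>g. AE x in cube_measure. q k x = g (x $ k)) \<and>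
    (\<forall>t. sq_integrable cube_measure t \<and> (\<exists>g. AE x in cube_measure. t x = g (x $ k))
      \<longrightarrow> (\<integral>x. (r x $ Some k - q k x) * t x \<partial>cube_measure) = 0)"
    by (elim exE)
  define s :: "'d fn_tuple" where "s x = (\<chi> l. case l of None \<Rightarrow> p x | Some k \<Rightarrow> q k x)" for x
  have s: "s x $ None = p x" "s x $ Some k = q k x" for x k
    by (simp_all add: s_def)
  have "sq_integrable cube_measure (\<lambda>x. s x $ l)" for l
    by (cases l) (simp_all add: s p q)
  then have "s \<in> F_add"
    using p(2) q by (simp add: F_add_def F_full_iff s)
  moreover have "l2_inner (r - s) t = 0" if t: "t \<in> F_add" for t
  proof -
    have sq: "sq_integrable cube_measure (\<lambda>x. t x $ l)" for l
      using t by (simp add: F_add_def F_full_iff)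
    have "(\<integral>x. (r - s) x $ l * t x $ l \<partial>cube_measure) = 0" for l
    proof (cases l)
      case None
      have "\<exists>g. AE x in cube_measure. t x $ None = (\<Sum>k\<in>UNIV. g k (x $ k))"
        using t by (simp add: F_add_def)
      with p(3)[rule_format, of "\<lambda>x. t x $ None"] sq None show ?thesis
        by (simp add: s)
    next
      case (Some k)
      have "\<exists>g. AE x in cube_measure. t x $ Some k = g (x $ k)"
        using t by (simp add: F_add_def)
      with q[THEN spec[of _ k], THEN conjunct2, THEN conjunct2, rule_format, of "\<lambda>x. t x $ Some k"] sq Some
      show ?thesis by (simp add: s)
    qed
    then show ?thesis by (simp add: l2_inner_def)
  qed
  ultimately show ?thesis by blast
qed

subsection \<open>Quadratic forms on the space of tuples\<close>

lemma F_full_nth: "r \<in> F_full \<Longrightarrow> sq_integrable cube_measure (\<lambda>x. r x $ l)"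
  by (simp add: F_full_iff)

lemma F_add_imp_F_full: "r \<in> F_add \<Longrightarrow> r \<in> F_full"
  by (simp add: F_add_def)

lemma F_full_zero: "(\<lambda>x. 0) \<in> F_full"
  by (simp add: F_full_iff sq_integrable_zero)

lemma F_full_add_scaleR:
  assumes "r \<in> F_full" "s \<in> F_full"
  shows "(\<lambda>x. r x + c *\<^sub>R s x) \<in> F_full"
  using assms by (simp add: F_full_iff sq_integrable_add sq_integrable_scale)

lemma F_add_zero: "(\<lambda>x. 0) \<in> F_add"
proof -
  have "\<exists>f::'a \<Rightarrow> real \<Rightarrow> real. AE x in cube_measure. 0 = (\<Sum>k\<in>UNIV. f k (x $ k))"
    by (rule exI[of _ "\<lambda>_ _. 0"]) simp
  moreover have "\<exists>g::real \<Rightarrow> real. AE x in cube_measure. 0 = g (x $ k)" for k :: 'a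
    by (rule exI[of _ "\<lambda>_. 0"]) simp
  ultimately show ?thesis by (simp add: F_add_def F_full_zero)
qed

lemma F_add_add_scaleR:
  fixes r s :: "'d::finite fn_tuple"
  assumes "r \<in> F_add" "s \<in> F_add"
  shows "(\<lambda>x. r x + c *\<^sub>R s x) \<in> F_add"
proof -
  have "\<exists>f. AE x in cube_measure. r x $ None + c * s x $ None = (\<Sum>k\<in>UNIV. f k (x $ k))"
  proof -
    obtain f g where "AE x in cube_measure. r x $ None = (\<Sum>k\<in>UNIV. f k (x $ k))"
      "AE x in cube_measure. s x $ None = (\<Sum>k\<in>UNIV. g k (x $ k))"
      using assms unfolding F_add_def by blast
    then have "AE x in cube_measure. r x $ None + c * s x $ None = (\<Sum>k\<in>UNIV. f k (x $ k) + c * g k (x $ k))"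
      by eventually_elim (simp add: sum.distrib sum_distrib_left)
    then show ?thesis by (rule exI[of _ "\<lambda>k u. f k u + c * g k u"])
  qed
  moreover have "\<exists>f. AE x in cube_measure. r x $ Some k + c * s x $ Some k = f (x $ k)" for k
  proof -
    obtain f g where "AE x in cube_measure. r x $ Some k = f (x $ k)"
      "AE x in cube_measure. s x $ Some k = g (x $ k)"
      using assms unfolding F_add_def by blast
    then have "AE x in cube_measure. r x $ Some k + c * s x $ Some k = f (x $ k) + c * g (x $ k)"
      by eventually_elim simp
    then show ?thesis by (rule exI[of _ "\<lambda>u. f u + c * g u"])
  qed
  ultimately show ?thesis
    using assms F_full_add_scaleR[of r s c] by (simp add: F_add_def)
qed

lemma fn_tuple_diff: "r - s = (\<lambda>x. r x + (-1) *\<^sub>R s x)" for r s :: "'d::finite fn_tuple"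
  by (simp add: fun_eq_iff)

lemma F_full_diff: "r \<in> F_full \<Longrightarrow> s \<in> F_full \<Longrightarrow> r - s \<in> F_full"
  unfolding fn_tuple_diff by (rule F_full_add_scaleR)

lemma F_add_diff: "r \<in> F_add \<Longrightarrow> s \<in> F_add \<Longrightarrow> r - s \<in> F_add"
  unfolding fn_tuple_diff by (rule F_add_add_scaleR)

section \<open>The inner product and equality almost everywhere\<close>

lemma l2_inner_commute: "l2_inner r s = l2_inner s r"
  by (simp add: l2_inner_def mult.commute)

lemma l2_inner_zero [simp]: "l2_inner (\<lambda>x. 0) r = 0"
  by (simp add: l2_inner_def)

lemma l2_inner_add_scaleR_left:
  assumes "r \<in> F_full" "s \<in> F_full" "t \<in> F_full"
  shows "l2_inner (\<lambda>x. r x + c *\<^sub>R s x) t = l2_inner r t + c * l2_inner s t"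
proof -
  have "(\<integral>x. (r x + c *\<^sub>R s x) $ l * t x $ l \<partial>cube_measure)
    = (\<integral>x. r x $ l * t x $ l \<partial>cube_measure) + c * (\<integral>x. s x $ l * t x $ l \<partial>cube_measure)" for l
    using sq_integrable_mult_integrable[OF F_full_nth[OF assms(1)] F_full_nth[OF assms(3)]]
      sq_integrable_mult_integrable[OF F_full_nth[OF assms(2)] F_full_nth[OF assms(3)]]
    by (simp add: distrib_right mult.assoc)
  then show ?thesis by (simp add: l2_inner_def sum.distrib sum_distrib_left)
qed

lemma l2_inner_add_scaleR_right:
  assumes "r \<in> F_full" "s \<in> F_full" "t \<in> F_full"
  shows "l2_inner t (\<lambda>x. r x + c *\<^sub>R s x) = l2_inner t r + c * l2_inner t s"
  using l2_inner_add_scaleR_left[OF assms] by (simp add: l2_inner_commute)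

lemma l2_inner_diff_left:
  assumes "r \<in> F_full" "s \<in> F_full" "t \<in> F_full"
  shows "l2_inner (r - s) t = l2_inner r t - l2_inner s t"
  unfolding fn_tuple_diff using l2_inner_add_scaleR_left[OF assms, of "-1"] by (simp del: scaleR_minus_left)

lemma l2_inner_cong:
  assumes "r \<in> F_full" "r' \<in> F_full" "s \<in> F_full" "l2_eq r r'"
  shows "l2_inner r s = l2_inner r' s"
proof -
  have "(\<integral>x. r x $ l * s x $ l \<partial>cube_measure) = (\<integral>x. r' x $ l * s x $ l \<partial>cube_measure)" for l
  proof (rule integral_cong_AE)
    note [measurable] = sq_integrable_measurable[OF F_full_nth[OF assms(1)]]
      sq_integrable_measurable[OF F_full_nth[OF assms(2)]]
      sq_integrable_measurable[OF F_full_nth[OF assms(3)]]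
    show "(\<lambda>x. r x $ l * s x $ l) \<in> borel_measurable cube_measure" by measurable
    show "(\<lambda>x. r' x $ l * s x $ l) \<in> borel_measurable cube_measure" by measurable
    show "AE x in cube_measure. r x $ l * s x $ l = r' x $ l * s x $ l"
      using assms(4) unfolding l2_eq_def by eventually_elim simp
  qed
  then show ?thesis by (simp add: l2_inner_def)
qed

lemma l2_inner_self_nonneg: "l2_inner r r \<ge> 0"
  by (simp add: l2_inner_def sum_nonneg)

lemma l2_norm_eq: "l2_norm r = sqrt (l2_inner r r)"
  by (simp add: l2_norm_def l2_inner_def power2_eq_square)

lemma l2_inner_self_eq_0:
  assumes "r \<in> F_full" "l2_inner r r = 0"
  shows "l2_eq r (\<lambda>x. 0)"
proof -
  have "\<forall>l. (\<integral>x. r x $ l * r x $ l \<partial>cube_measure) = 0"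
    using assms(2) unfolding l2_inner_def by (subst (asm) sum_nonneg_eq_0_iff) auto
  then have "AE x in cube_measure. r x $ l * r x $ l = 0" for l
    using sq_integrable_mult_integrable[OF F_full_nth[OF assms(1)] F_full_nth[OF assms(1)]]
    by (subst integral_nonneg_eq_0_iff_AE[symmetric]) auto
  then have "AE x in cube_measure. \<forall>l. r x $ l = 0"
    by (simp add: AE_all_countable)
  then show ?thesis
    unfolding l2_eq_def by eventually_elim (simp add: vec_eq_iff)
qed

lemma l2_eq_sym: "l2_eq r s \<Longrightarrow> l2_eq s r"
  unfolding l2_eq_def by (erule eventually_mono) simp

lemma l2_eq_trans: "l2_eq r s \<Longrightarrow> l2_eq s t \<Longrightarrow> l2_eq r t"
  unfolding l2_eq_def by (auto elim: eventually_elim2)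

lemma l2_eq_diff_0: "l2_eq (r - s) (\<lambda>x. 0) \<longleftrightarrow> l2_eq r s"
  by (simp add: l2_eq_def)

lemma l2_norm_cong:
  assumes "r \<in> F_full" "r' \<in> F_full" "l2_eq r r'"
  shows "l2_norm r = l2_norm r'"
  using l2_inner_cong[of r r' r] l2_inner_cong[of r r' r'] assms
  by (simp add: l2_norm_eq l2_inner_commute)

text \<open>Existence turns the choice in \<open>P_add\<close> into its characterization; all later
  arguments use only these two facts.\<close>

lemma P_add_projection:
  assumes "r \<in> F_full"
  shows "P_add r \<in> F_add" and "\<And>t. t \<in> F_add \<Longrightarrow> l2_inner (P_add r) t = l2_inner r t"
proof -
  have P: "P_add r \<in> F_add \<and> (\<forall>t\<in>F_add. l2_inner (r - P_add r) t = 0)"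
    using someI_ex[of "\<lambda>s. s \<in> F_add \<and> (\<forall>t\<in>F_add. l2_inner (r - s) t = 0)"] P_add_exists[OF assms]
    unfolding P_add_def by blast
  then show "P_add r \<in> F_add" by blast
  show "l2_inner (P_add r) t = l2_inner r t" if "t \<in> F_add" for t
    using l2_inner_diff_left[OF assms F_add_imp_F_full F_add_imp_F_full[OF that], of "P_add r"] P that
    by fastforce
qed

text \<open>The difference \<open>r - s\<close> is itself an admissible test function and is
  orthogonal to itself.\<close>

lemma F_add_l2_eqI:
  assumes "r \<in> F_add" "s \<in> F_add" "\<And>t. t \<in> F_add \<Longrightarrow> l2_inner r t = l2_inner s t"
  shows "l2_eq r s"
proof -
  have "l2_inner (r - s) (r - s) = 0"
    using assms F_add_diff[OF assms(1,2)] by (simp add: l2_inner_diff_left F_add_imp_F_full)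
  then show ?thesis
    using l2_inner_self_eq_0 F_add_diff[OF assms(1,2)] F_add_imp_F_full l2_eq_diff_0 by blast
qed

lemma P_add_of_F_add: "r \<in> F_add \<Longrightarrow> l2_eq (P_add r) r"
  by (rule F_add_l2_eqI) (simp_all add: P_add_projection F_add_imp_F_full)

text \<open>Up to null sets the projection shifts by the same \<open>c *\<^sub>R t\<close>, so the
  residual is unchanged. This makes the penalty constant along directions in
  \<open>F_add\<close>.\<close>

lemma l2_norm_residual_add_F_add:
  fixes r t :: "'d::finite fn_tuple"
  assumes r: "r \<in> F_full" and t: "t \<in> F_add"
  shows "l2_norm ((\<lambda>x. r x + c *\<^sub>R t x) - P_add (\<lambda>x. r x + c *\<^sub>R t x)) = l2_norm (r - P_add r)"
proof -
  let ?r = "\<lambda>x. r x + c *\<^sub>R t x" and ?p = "\<lambda>x. P_add r x + c *\<^sub>R t x"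
  note t' = F_add_imp_F_full[OF t]
  have r': "?r \<in> F_full" by (rule F_full_add_scaleR[OF r t'])
  have p: "?p \<in> F_add" by (rule F_add_add_scaleR[OF P_add_projection(1)[OF r] t])
  have "l2_eq (P_add ?r) ?p"
  proof (rule F_add_l2_eqI[OF P_add_projection(1)[OF r'] p])
    fix s :: "'d fn_tuple" assume s: "s \<in> F_add"
    show "l2_inner (P_add ?r) s = l2_inner ?p s"
      using r t' s P_add_projection[OF r] P_add_projection(2)[OF r' s]
      by (simp add: l2_inner_add_scaleR_left F_add_imp_F_full)
  qed
  then have "l2_eq (?r - P_add ?r) (r - P_add r)"
    unfolding l2_eq_def by eventually_elim simp
  then show ?thesis
    using r r' P_add_projection(1) F_add_imp_F_full F_full_diff by (intro l2_norm_cong) blast+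
qed

text \<open>The first-order condition for a quadratic in \<open>c\<close> with minimum at
  \<open>0\<close>. It serves both stationarity and the Cauchy-Schwarz argument.\<close>

lemma linear_coefficient_zero:
  fixes a b :: real
  assumes "\<And>c. 0 \<le> 2 * c * a + c\<^sup>2 * b"
  shows "a = 0"
proof (rule ccontr)
  assume "a \<noteq> 0"
  \<comment> \<open>A positive upper bound of \<open>b\<close>, whatever its sign;
    \<open>c = - a / d\<close> minimizes the quadratic with \<open>b\<close> replaced by
    \<open>d\<close>, with value \<open>- (a\<^sup>2 / d)\<close>.\<close>
  define d where "d = \<bar>b\<bar> + 1"
  have d: "d > 0" "b \<le> d" by (simp_all add: d_def)
  define c where "c = - a / d"
  have "2 * c * a + c\<^sup>2 * b \<le> 2 * c * a + c\<^sup>2 * d"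
    using d by (intro add_left_mono mult_left_mono) auto
  also have "\<dots> = - (a\<^sup>2 / d)"
    using d by (simp add: c_def field_simps power2_eq_square)
  also have "\<dots> < 0"
    using \<open>a \<noteq> 0\<close> d by simp
  finally show False using assms[of c] by simp
qed

text \<open>An abstract semidefinite operator whose compression to \<open>F_add\<close> is
  invertible; \<open>S_star\<close> is the intended instance.\<close>

locale l2_quadratic_form =
  fixes S :: "'d::finite fn_tuple \<Rightarrow> 'd fn_tuple"
  assumes S_F_full: "r \<in> F_full \<Longrightarrow> S r \<in> F_full"
    and S_add_scaleR: "S (\<lambda>x. r x + c *\<^sub>R s x) = (\<lambda>x. S r x + c *\<^sub>R S s x)"
    and S_symmetric: "r \<in> F_full \<Longrightarrow> s \<in> F_full \<Longrightarrow> l2_inner (S r) s = l2_inner r (S s)"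
    and S_nonneg: "r \<in> F_full \<Longrightarrow> 0 \<le> l2_inner r (S r)"
    and S_inverse: "has_continuous_inverse_on F_add (\<lambda>r. P_add (S (P_add r)))"
begin

lemma compression_F_add: "s \<in> F_add \<Longrightarrow> P_add (S (P_add s)) \<in> F_add"
  using P_add_projection(1) S_F_full F_add_imp_F_full by blast

text \<open>On \<open>F_add\<close> the projection is the identity up to null sets and drops out
  against test functions, so the compression has the same form as \<open>S\<close>.\<close>

lemma l2_inner_compression:
  assumes "s \<in> F_add" "t \<in> F_add"
  shows "l2_inner (P_add (S (P_add s))) t = l2_inner (S s) t"
proof -
  note full = assms[THEN F_add_imp_F_full]
  note Ps = P_add_projection(1)[OF full(1), THEN F_add_imp_F_full]
  have "l2_inner (P_add (S (P_add s))) t = l2_inner (S (P_add s)) t"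
    using P_add_projection(2)[OF S_F_full[OF Ps] assms(2)] .
  \<comment> \<open>Moving \<open>S\<close> to the other side leaves \<open>P_add s\<close> as a
    bare argument, so that only the inner product has to respect \<open>l2_eq\<close>.\<close>
  also have "\<dots> = l2_inner (P_add s) (S t)"
    using S_symmetric[OF Ps full(2)] .
  also have "\<dots> = l2_inner s (S t)"
    using l2_inner_cong[OF Ps full(1) S_F_full[OF full(2)] P_add_of_F_add[OF assms(1)]] .
  finally show ?thesis using S_symmetric[OF full] by simp
qed

lemma normal_equation_solvable:
  assumes "b \<in> F_full"
  shows "\<exists>s\<in>F_add. \<forall>t\<in>F_add. l2_inner (S s) t = l2_inner b t"
proof -
  obtain T where T: "\<And>r. r \<in> F_add \<Longrightarrow> T r \<in> F_add \<and> l2_eq (P_add (S (P_add (T r)))) r"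
    using S_inverse unfolding has_continuous_inverse_on_def by blast
  define s where "s = T (P_add b)"
  have s: "s \<in> F_add" "l2_eq (P_add (S (P_add s))) (P_add b)"
    using T P_add_projection(1)[OF assms] by (auto simp: s_def)
  have "l2_inner (S s) t = l2_inner b t" if t: "t \<in> F_add" for t
  proof -
    have "l2_inner (S s) t = l2_inner (P_add (S (P_add s))) t"
      using l2_inner_compression[OF s(1) t] by simp
    also have "\<dots> = l2_inner (P_add b) t"
      using compression_F_add[OF s(1)] P_add_projection(1)[OF assms] t s(2)
      by (intro l2_inner_cong F_add_imp_F_full)
    finally show ?thesis using P_add_projection(2)[OF assms t] by simp
  qed
  with s(1) show ?thesis by blast
qed

lemma quadratic_form_expand:
  assumes "r \<in> F_full" "t \<in> F_full"
  shows "l2_inner (\<lambda>x. r x + c *\<^sub>R t x) (S (\<lambda>x. r x + c *\<^sub>R t x))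
    = l2_inner r (S r) + 2 * c * l2_inner (S r) t + c\<^sup>2 * l2_inner t (S t)"
proof -
  have "l2_inner r (S t) = l2_inner (S r) t" "l2_inner t (S r) = l2_inner (S r) t"
    using S_symmetric[OF assms] by (simp_all add: l2_inner_commute)
  then show ?thesis
    using assms unfolding S_add_scaleR
    by (simp add: l2_inner_add_scaleR_left l2_inner_add_scaleR_right F_full_add_scaleR S_F_full
        power2_eq_square algebra_simps)
qed

text \<open>A null vector of a semidefinite form is orthogonal to everything under the form. Hence
  the compression sends \<open>s\<close> to zero, and injectivity, which the inverse supplies, gives
  \<open>s = 0\<close>, all up to null sets.\<close>

lemma definite_on_F_add:
  assumes s: "s \<in> F_add" and 0: "l2_inner s (S s) = 0"
  shows "l2_eq s (\<lambda>x. 0)"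
proof -
  let ?A = "\<lambda>r. P_add (S (P_add r))" and ?o = "(\<lambda>x. 0) :: 'd fn_tuple"
  obtain T where T: "\<And>r. r \<in> F_add \<Longrightarrow> T r \<in> F_add \<and> l2_eq (T (?A r)) r"
    and cont: "\<And>r \<epsilon>. r \<in> F_add \<Longrightarrow> \<epsilon> > 0 \<Longrightarrow>
      \<exists>\<delta>>0. \<forall>s\<in>F_add. l2_norm (s - r) < \<delta> \<longrightarrow> l2_norm (T s - T r) < \<epsilon>"
    using S_inverse unfolding has_continuous_inverse_on_def by blast
  have null: "l2_inner (?A r) t = 0"
    if r: "r \<in> F_add" "l2_inner r (S r) = 0" and t: "t \<in> F_add" for r t
  proof -
    note full = r(1)[THEN F_add_imp_F_full] t[THEN F_add_imp_F_full]
    \<comment> \<open>The form at \<open>r + c *\<^sub>R t\<close> is nonnegative, and its constant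
      term vanishes.\<close>
    have "0 \<le> 2 * c * l2_inner (S r) t + c\<^sup>2 * l2_inner t (S t)" for c
      using S_nonneg[OF F_full_add_scaleR[OF full, of c]] quadratic_form_expand[OF full, of c] r(2)
      by simp
    then show ?thesis
      using linear_coefficient_zero l2_inner_compression[OF r(1) t] by metis
  qed
  have As: "?A s \<in> F_add" "?A ?o \<in> F_add"
    using s by (simp_all add: compression_F_add F_add_zero)
  \<comment> \<open>Since \<open>P_add\<close> chooses representatives, \<open>?A ?o\<close> is zero
    only almost everywhere; both images are therefore shown to be orthogonal to all of
    \<open>F_add\<close>.\<close>
  have "l2_eq (?A s) (?A ?o)"
    using null[OF s 0] null[OF F_add_zero l2_inner_zero] by (intro F_add_l2_eqI As) simp
  then have "l2_norm (?A s - ?A ?o) = l2_norm ?o"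
    using As by (intro l2_norm_cong F_full_diff F_add_imp_F_full F_full_zero) (simp_all add: l2_eq_diff_0)
  then have A0: "l2_norm (?A s - ?A ?o) = 0"
    by (simp add: l2_norm_eq)
  \<comment> \<open>\<open>T\<close> acts on representatives; its continuity makes it respect \<open>l2_eq\<close>.\<close>
  have "l2_norm (T (?A s) - T (?A ?o)) < \<epsilon>" if "\<epsilon> > 0" for \<epsilon>
    using cont[OF As(2) that] As(1) A0 by auto
  then have "l2_norm (T (?A s) - T (?A ?o)) \<le> 0"
    by (meson field_le_epsilon less_le_trans linorder_not_le order.irrefl)
  then have "l2_inner (T (?A s) - T (?A ?o)) (T (?A s) - T (?A ?o)) = 0"
    using l2_inner_self_nonneg[of "T (?A s) - T (?A ?o)"] by (simp add: l2_norm_eq)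
  then have "l2_eq (T (?A s)) (T (?A ?o))"
    using T As l2_inner_self_eq_0 F_full_diff F_add_imp_F_full l2_eq_diff_0 by metis
  then show ?thesis
    using T s F_add_zero l2_eq_sym l2_eq_trans by metis
qed

text \<open>A common form of both least-squares problems: \<open>Q\<close> has
  \<open>b = response_vec K h n X Y\<close>, and the squared seminorm distance to \<open>r\<close>
  has \<open>b = S r\<close>.\<close>

context
  fixes J :: "'d fn_tuple \<Rightarrow> real" and b :: "'d fn_tuple" and c0 :: real
  assumes b: "b \<in> F_full"
    and J: "\<And>r. r \<in> F_full \<Longrightarrow> J r = c0 - 2 * l2_inner b r + l2_inner r (S r)"
begin

lemma quadratic_expand:
  assumes "r \<in> F_full" "t \<in> F_full"
  shows "J (\<lambda>x. r x + c *\<^sub>R t x)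
    = J r + 2 * c * (l2_inner (S r) t - l2_inner b t) + c\<^sup>2 * l2_inner t (S t)"
  using assms b quadratic_form_expand[OF assms, of c]
  by (simp add: J F_full_add_scaleR l2_inner_add_scaleR_right algebra_simps)

lemma stationary_point:
  assumes "r \<in> F_full" "t \<in> F_full" "\<And>c. J r \<le> J (\<lambda>x. r x + c *\<^sub>R t x)"
  shows "l2_inner (S r) t = l2_inner b t"
  using linear_coefficient_zero[of "l2_inner (S r) t - l2_inner b t" "l2_inner t (S t)"]
    assms(3) quadratic_expand[OF assms(1,2)] by simp

text \<open>Minimality along each line in \<open>F_add\<close> gives the normal equations.
  Conversely they remove the linear term of the expansion, and the remaining quadratic term is
  nonnegative.\<close>

lemma arg_min_iff:
  "is_arg_min J (\<lambda>s. s \<in> F_add) s \<longleftrightarrow> s \<in> F_add \<and> (\<forall>t\<in>F_add. l2_inner (S s) t = l2_inner b t)"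
proof safe
  assume min: "is_arg_min J (\<lambda>s. s \<in> F_add) s"
  then show s: "s \<in> F_add" by (simp add: is_arg_min_def)
  fix t :: "'d fn_tuple" assume t: "t \<in> F_add"
  have "J s \<le> J (\<lambda>x. s x + c *\<^sub>R t x)" for c
    using min F_add_add_scaleR[OF s t, of c] by (auto simp: is_arg_min_def not_less)
  then show "l2_inner (S s) t = l2_inner b t"
    using stationary_point s t F_add_imp_F_full by blast
next
  assume s: "s \<in> F_add" and eq: "\<forall>t\<in>F_add. l2_inner (S s) t = l2_inner b t"
  have "J s \<le> J r" if r: "r \<in> F_add" for r
  proof -
    let ?d = "r - s"
    note d = F_add_diff[OF r s]
    have "J r = J (\<lambda>x. s x + 1 *\<^sub>R ?d x)" by simp
    also have "\<dots> = J s + l2_inner ?d (S ?d)"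
      using quadratic_expand[OF F_add_imp_F_full[OF s] F_add_imp_F_full[OF d], of 1] eq d by simp
    finally show ?thesis using S_nonneg[OF F_add_imp_F_full[OF d]] by simp
  qed
  with s show "is_arg_min J (\<lambda>s. s \<in> F_add) s"
    by (auto simp: is_arg_min_def not_less)
qed

text \<open>Subtracting the two normal equations and testing with \<open>s - t\<close> makes the
  form vanish at the difference, where it is definite.\<close>

lemma arg_min_unique:
  assumes "is_arg_min J (\<lambda>s. s \<in> F_add) s" "is_arg_min J (\<lambda>s. s \<in> F_add) t"
  shows "l2_eq s t"
proof -
  have F: "s \<in> F_add" "t \<in> F_add" using assms by (simp_all add: is_arg_min_def)
  note full = F[THEN F_add_imp_F_full]
  note d = F_add_diff[OF F]
  have "S (s - t) = S s - S t"
    unfolding fn_tuple_diff by (rule S_add_scaleR)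
  then have "l2_inner (s - t) (S (s - t)) = l2_inner (S s) (s - t) - l2_inner (S t) (s - t)"
    using full F_add_imp_F_full[OF d] by (simp add: l2_inner_commute[of "s - t"] l2_inner_diff_left S_F_full)
  also have "\<dots> = 0"
    using assms d by (simp add: arg_min_iff)
  finally show ?thesis
    using definite_on_F_add[OF d] l2_eq_diff_0 by blast
qed

lemma has_unique_minimizer: "has_unique_minimizer_on F_add J"
  unfolding has_unique_minimizer_on_def
  using normal_equation_solvable[OF b] arg_min_unique by (metis arg_min_iff)

lemma is_arg_min_arg_min: "is_arg_min J (\<lambda>s. s \<in> F_add) (arg_min J (\<lambda>s. s \<in> F_add))"
  using has_unique_minimizer unfolding has_unique_minimizer_on_def arg_min_def by (metis someI)

end

end

subsection \<open>Local linear smoothing\<close>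

lemma sum_option_UNIV:
  fixes f :: "'d::finite option \<Rightarrow> 'b::comm_monoid_add"
  shows "(\<Sum>l\<in>UNIV. f l) = f None + (\<Sum>k\<in>UNIV. f (Some k))"
  by (simp add: UNIV_option_conv sum.reindex)

lemma integrable_cube_measure_continuous:
  fixes f :: "real^'d::finite \<Rightarrow> real"
  assumes "continuous_on (cbox 0 1) f"
  shows "integrable cube_measure f"
  using assms unfolding cube_measure_def by (rule continuous_imp_integrable)

lemma sq_integrable_continuous:
  fixes f :: "real^'d::finite \<Rightarrow> real"
  assumes "continuous_on (cbox 0 1) f"
  shows "sq_integrable cube_measure f"
  using integrable_cube_measure_continuous[OF assms]
    integrable_cube_measure_continuous[OF continuous_on_power[OF assms, of 2]]
  by (auto simp: sq_integrable_def)

lemma sq_integrable_continuous_mult: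
  fixes f :: "real^'d::finite \<Rightarrow> real"
  assumes f: "sq_integrable cube_measure f" and g: "continuous_on (cbox 0 1) g"
  shows "sq_integrable cube_measure (\<lambda>x. g x * f x)"
proof -
  have "bounded (g ` cbox 0 1)"
    using g by (intro compact_imp_bounded compact_continuous_image) auto
  then obtain B where "\<And>x. x \<in> cbox 0 1 \<Longrightarrow> \<bar>g x\<bar> \<le> B"
    by (auto simp: bounded_iff)
  moreover have "space cube_measure = (cbox 0 1 :: (real^'d) set)"
    by (simp add: cube_measure_def)
  ultimately show ?thesis
    using sq_integrable_measurable[OF sq_integrable_continuous[OF g]]
    by (intro sq_integrable_bounded_mult[OF f]) auto
qed

lemma l2_inner_eq_integral_inner:
  assumes "r \<in> F_full" "s \<in> F_full"
  shows "l2_inner r s = (\<integral>x. r x \<bullet> s x \<partial>cube_measure)" "integrable cube_measure (\<lambda>x. r x \<bullet> s x)"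
  using sq_integrable_mult_integrable[OF F_full_nth[OF assms(1)] F_full_nth[OF assms(2)]]
  by (simp_all add: l2_inner_def inner_vec_def)

lemma u_vec_inner:
  fixes v :: "real^('d::finite option)"
  shows "u_vec h Z x \<bullet> v = v $ None + (\<Sum>k\<in>UNIV. v $ Some k * ((Z $ k - x $ k) / h $ k))"
  by (simp add: inner_vec_def sum_option_UNIV u_vec_def mult.commute)

lemma S_mat_mult_vec:
  fixes v :: "real^('d::finite option)"
  shows "S_mat K h n X x *v v
    = (1 / real n) *\<^sub>R (\<Sum>i=1..n. (K_h K h (X i) x * (u_vec h (X i) x \<bullet> v)) *\<^sub>R u_vec h (X i) x)"
proof -
  have "(\<Sum>m\<in>UNIV. (\<Sum>i=1..n. K_h K h (X i) x * u_vec h (X i) x $ l * u_vec h (X i) x $ m) * v $ m)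
    = (\<Sum>i=1..n. K_h K h (X i) x * (\<Sum>m\<in>UNIV. u_vec h (X i) x $ m * v $ m) * u_vec h (X i) x $ l)" for l
    by (simp add: sum_distrib_left sum_distrib_right mult_ac) (rule sum.swap)
  then show ?thesis
    by (simp add: vec_eq_iff matrix_vector_mult_def S_mat_def inner_vec_def sum_component
        sum_divide_distrib[symmetric])
qed

lemma S_star_inner:
  "w \<bullet> S_star K h n X r x
    = 1 / real n * (\<Sum>i=1..n. K_h K h (X i) x * (u_vec h (X i) x \<bullet> r x) * (u_vec h (X i) x \<bullet> w))"
  by (simp add: S_star_def S_mat_mult_vec inner_sum_right inner_commute mult.assoc)

text \<open>The weighted least-squares moment vector of the responses, that is, the \<open>b\<close>
  in the linear term of \<open>Q\<close>.\<close>

definition response_vec ::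
    "(real \<Rightarrow> real) \<Rightarrow> real^'d \<Rightarrow> nat \<Rightarrow> (nat \<Rightarrow> real^'d) \<Rightarrow> (nat \<Rightarrow> real) \<Rightarrow> 'd::finite fn_tuple" where
  "response_vec K h n X Y = (\<lambda>x. (1 / real n) *\<^sub>R (\<Sum>i=1..n. (K_h K h (X i) x * Y i) *\<^sub>R u_vec h (X i) x))"

lemma K_h_nonneg:
  assumes "\<And>u. K u \<ge> 0"
  shows "K_h K h Z x \<ge> 0"
  unfolding K_h_def by (intro prod_nonneg divide_nonneg_nonneg) (simp_all add: assms)

locale kernel_design =
  fixes K :: "real \<Rightarrow> real" and h :: "real^'d::finite" and n :: nat and X :: "nat \<Rightarrow> real^'d"
  assumes K_nonneg: "\<And>u. K u \<ge> 0"
    and K_continuous: "continuous_on UNIV K"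
    and h_pos: "\<And>k. h $ k > 0"
begin

lemma continuous_on_K_h: "continuous_on A (K_h K h Z)"
proof -
  have "continuous_on A (\<lambda>x. K ((Z $ k - x $ k) / h $ k))" for k
    using h_pos[of k] by (intro continuous_on_compose2[OF K_continuous] continuous_intros) auto
  then show ?thesis
    \<comment> \<open>The normalizing integrals do not depend on \<open>x\<close>, so their inverses
      are constant factors; this covers a vanishing integral too.\<close>
    unfolding K_h_def[abs_def] divide_inverse by (intro continuous_intros)
qed

lemma continuous_on_u_vec: "continuous_on A (\<lambda>x. u_vec h Z x $ l)"
proof (cases l)
  case (Some k)
  then show ?thesis
    using h_pos[of k] by (simp add: u_vec_def) (intro continuous_intros, auto)
qed (simp add: u_vec_def)

lemma continuous_on_S_mat: "continuous_on A (\<lambda>x. S_mat K h n X x $ l $ m)"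
  unfolding S_mat_def vec_lambda_beta
  by (intro continuous_on_mult continuous_on_sum continuous_on_const continuous_on_K_h continuous_on_u_vec)

text \<open>The matrix entries are continuous on the compact cube, hence bounded, and bounded
  multipliers preserve square integrability.\<close>

lemma S_star_F_full:
  assumes "r \<in> F_full"
  shows "S_star K h n X r \<in> F_full"
  unfolding F_full_iff S_star_def matrix_vector_mult_def
  by (auto intro!: sq_integrable_sum sq_integrable_continuous_mult F_full_nth[OF assms] continuous_on_S_mat)

lemma response_vec_F_full: "response_vec K h n X Y \<in> F_full"
  unfolding F_full_iff response_vec_def vector_scaleR_component sum_component
  by (intro allI sq_integrable_continuous continuous_on_scaleR continuous_on_mult continuous_on_sum
      continuous_on_const continuous_on_K_h continuous_on_u_vec)

lemma star_seminorm_power2: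
  assumes "r \<in> F_full"
  shows "(star_seminorm K h n X r)\<^sup>2 = l2_inner r (S_star K h n X r)"
proof -
  have eq: "1 / real n * (\<Sum>i=1..n. (r x $ None + (\<Sum>k\<in>UNIV. r x $ Some k * ((X i $ k - x $ k) / h $ k)))\<^sup>2
      * K_h K h (X i) x) = r x \<bullet> S_star K h n X r x" for x
    unfolding u_vec_inner[symmetric] S_star_inner by (simp add: power2_eq_square mult_ac)
  \<comment> \<open>The seminorm is a square root, so squaring it returns the integral only once the
    integral is known to be nonnegative.\<close>
  have "0 \<le> r x \<bullet> S_star K h n X r x" for x
    unfolding eq[symmetric] by (intro mult_nonneg_nonneg sum_nonneg) (auto simp: K_h_nonneg K_nonneg)
  then show ?thesis
    unfolding star_seminorm_def eq l2_inner_eq_integral_inner(1)[OF assms S_star_F_full[OF assms]]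
    by (simp add: Bochner_Integration.integral_nonneg)
qed

text \<open>The weighted squares expand pointwise into a constant, a linear and a quadratic term in
  \<open>r\<close>, each of which is integrable on its own.\<close>

lemma Q_eq:
  assumes "r \<in> F_full"
  shows "Q K h n X Y r = (\<integral>x. 1 / real n * (\<Sum>i=1..n. (Y i)\<^sup>2 * K_h K h (X i) x) \<partial>cube_measure)
    - 2 * l2_inner (response_vec K h n X Y) r + l2_inner r (S_star K h n X r)"
proof -
  let ?b = "response_vec K h n X Y"
  have "1 / real n * (\<Sum>i=1..n. (Y i - r x $ None - (\<Sum>k\<in>UNIV. r x $ Some k * ((X i $ k - x $ k) / h $ k)))\<^sup>2
      * K_h K h (X i) x)
    = 1 / real n * (\<Sum>i=1..n. (Y i)\<^sup>2 * K_h K h (X i) x) - 2 * (?b x \<bullet> r x) + r x \<bullet> S_star K h n X r x"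
    (is "?L x = ?R x") for x
  proof -
    let ?K = "\<lambda>i. K_h K h (X i) x" and ?u = "\<lambda>i. u_vec h (X i) x \<bullet> r x"
    have "?L x = 1 / real n * (\<Sum>i=1..n. (Y i - ?u i)\<^sup>2 * ?K i)"
      by (simp add: u_vec_inner diff_diff_eq)
    also have "(\<Sum>i=1..n. (Y i - ?u i)\<^sup>2 * ?K i)
      = (\<Sum>i=1..n. (Y i)\<^sup>2 * ?K i) - 2 * (\<Sum>i=1..n. ?K i * Y i * ?u i) + (\<Sum>i=1..n. ?K i * ?u i * ?u i)"
      by (simp add: sum_distrib_left sum_subtractf[symmetric] sum.distrib[symmetric] power2_eq_square algebra_simps)
    finally show ?thesis
      by (simp add: S_star_inner response_vec_def inner_sum_left distrib_left right_diff_distrib)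
  qed
  moreover have "integrable cube_measure (\<lambda>x. 1 / real n * (\<Sum>i=1..n. (Y i)\<^sup>2 * K_h K h (X i) x))"
    by (intro integrable_cube_measure_continuous continuous_intros continuous_on_K_h)
  ultimately show ?thesis
    using l2_inner_eq_integral_inner[OF response_vec_F_full assms, of Y]
      l2_inner_eq_integral_inner[OF assms S_star_F_full[OF assms]]
    unfolding Q_def by simp
qed

lemma S_star_symmetric:
  assumes "r \<in> F_full" "s \<in> F_full"
  shows "l2_inner (S_star K h n X r) s = l2_inner r (S_star K h n X s)"
proof -
  have "s x \<bullet> S_star K h n X r x = r x \<bullet> S_star K h n X s x" for x
    by (simp add: S_star_inner mult_ac)
  then show ?thesis
    using assms by (simp add: l2_inner_commute[of _ s] l2_inner_eq_integral_inner S_star_F_full)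
qed

lemma l2_quadratic_form_S_star:
  assumes "has_continuous_inverse_on F_add (S_add K h n X)"
  shows "l2_quadratic_form (S_star K h n X)"
proof
  show "has_continuous_inverse_on F_add (\<lambda>r. P_add (S_star K h n X (P_add r)))"
    using assms by (simp add: S_add_def[abs_def])
  show "S_star K h n X (\<lambda>x. r x + c *\<^sub>R s x) = (\<lambda>x. S_star K h n X r x + c *\<^sub>R S_star K h n X s x)"
    for r s :: "'d fn_tuple" and c
    by (simp add: S_star_def matrix_vector_right_distrib matrix_vector_mult_scaleR)
  show "0 \<le> l2_inner r (S_star K h n X r)" if "r \<in> F_full" for r
    by (simp add: star_seminorm_power2[OF that, symmetric])
qed (rule S_star_F_full S_star_symmetric; assumption)+

end

theorem proposition4:
  fixes K :: "real \<Rightarrow> real"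
    and h :: "real^'d::finite"
    and n :: nat
    and X :: "nat \<Rightarrow> real^'d"
    and Y :: "nat \<Rightarrow> real"
    and R :: real
    and r_R :: "real^'d \<Rightarrow> real^('d option)"
  assumes "\<And>u. K u \<ge> 0"
    and "bounded (range K)"
    and "compact (closure {u. K u \<noteq> 0})"
    and "\<And>u. K (- u) = K u"
    and "\<exists>L. L-lipschitz_on UNIV K"
    and "\<And>k. h $ k > 0"
    and "n \<ge> 1"
    and "\<And>i. i \<in> {1..n} \<Longrightarrow> X i \<in> cbox 0 1"
    and "has_continuous_inverse_on F_add (S_add K h n X)"
    and "R \<ge> 0"
    and "is_penalized_estimator K h n X Y R r_R"
  shows "(\<forall>r\<in>F_full. has_unique_minimizer_on F_add (\<lambda>s. (star_seminorm K h n X (r - s))\<^sup>2)) \<and>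
         has_unique_minimizer_on F_add (Q K h n X Y) \<and>
         l2_eq (P_star K h n X r_R) (r_add K h n X Y)"
proof -
  interpret kernel_design K h n X
    using assms(1,5,6) by unfold_locales (auto intro: lipschitz_on_continuous_on)
  let ?S = "S_star K h n X" and ?b = "response_vec K h n X Y"
  interpret l2_quadratic_form ?S
    by (rule l2_quadratic_form_S_star[OF assms(9)])
  have proj: "(star_seminorm K h n X (r - s))\<^sup>2 = l2_inner r (?S r) - 2 * l2_inner (?S r) s + l2_inner s (?S s)"
    if "r \<in> F_full" "s \<in> F_full" for r s
    using quadratic_form_expand[OF that, of "-1"] star_seminorm_power2[OF F_full_diff[OF that]]
    by (simp add: fn_tuple_diff)
  \<comment> \<open>These pairs instantiate the abstract quadratic criterion, once for the
    projection and once for \<open>Q\<close>.\<close>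
  note proj_min = S_star_F_full proj
  note Q_min = response_vec_F_full Q_eq
  have r_R: "r_R \<in> F_full"
    using assms(11) by (simp add: is_penalized_estimator_def is_arg_min_def)
  have stationary: "l2_inner (?S r_R) t = l2_inner ?b t" if t: "t \<in> F_add" for t
  proof (rule stationary_point[OF Q_min r_R F_add_imp_F_full[OF t]])
    fix c
    \<comment> \<open>Along directions in \<open>F_add\<close> the penalties on both sides agree and
      cancel, so minimality of the penalized criterion becomes minimality of
      \<open>Q\<close>.\<close>
    have "\<not> Q K h n X Y (\<lambda>x. r_R x + c *\<^sub>R t x)
        + R * (l2_norm ((\<lambda>x. r_R x + c *\<^sub>R t x) - P_add (\<lambda>x. r_R x + c *\<^sub>R t x)))\<^sup>2
      < Q K h n X Y r_R + R * (l2_norm (r_R - P_add r_R))\<^sup>2"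
      using assms(11) F_full_add_scaleR[OF r_R F_add_imp_F_full[OF t], of c]
      unfolding is_penalized_estimator_def is_arg_min_def by blast
    then show "Q K h n X Y r_R \<le> Q K h n X Y (\<lambda>x. r_R x + c *\<^sub>R t x)"
      unfolding l2_norm_residual_add_F_add[OF r_R t] by simp
  qed
  have proj_iff: "is_arg_min (\<lambda>s. (star_seminorm K h n X (r_R - s))\<^sup>2) (\<lambda>s. s \<in> F_add) s \<longleftrightarrow>
      s \<in> F_add \<and> (\<forall>t\<in>F_add. l2_inner (?S s) t = l2_inner (?S r_R) t)" for s
    by (rule arg_min_iff[OF proj_min[OF r_R]])
  have Q_iff: "is_arg_min (Q K h n X Y) (\<lambda>s. s \<in> F_add) s \<longleftrightarrow>
      s \<in> F_add \<and> (\<forall>t\<in>F_add. l2_inner (?S s) t = l2_inner ?b t)" for s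
    by (rule arg_min_iff[OF Q_min])
  have "is_arg_min (\<lambda>s. (star_seminorm K h n X (r_R - s))\<^sup>2) (\<lambda>s. s \<in> F_add) (P_star K h n X r_R)"
    unfolding P_star_def by (rule is_arg_min_arg_min[OF proj_min[OF r_R]])
  \<comment> \<open>By \<open>stationary\<close> the right-hand sides of the two systems of normal
    equations coincide, so the projection also minimizes \<open>Q\<close>.\<close>
  then have "is_arg_min (Q K h n X Y) (\<lambda>r. r \<in> F_add) (P_star K h n X r_R)"
    using stationary by (simp add: proj_iff Q_iff)
  moreover have "is_arg_min (Q K h n X Y) (\<lambda>r. r \<in> F_add) (r_add K h n X Y)"
    unfolding r_add_def by (rule is_arg_min_arg_min[OF Q_min])
  ultimately have "l2_eq (P_star K h n X r_R) (r_add K h n X Y)"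
    by - (rule arg_min_unique[OF Q_min])
  moreover have "has_unique_minimizer_on F_add (\<lambda>s. (star_seminorm K h n X (r - s))\<^sup>2)" if "r \<in> F_full" for r
    by (rule has_unique_minimizer[OF proj_min[OF that]])
  moreover have "has_unique_minimizer_on F_add (Q K h n X Y)"
    by (rule has_unique_minimizer[OF Q_min])
  ultimately show ?thesis by blast
qed

end
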